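(* For every $\eta>0$ there exists an integer $n_0=n_0(\eta)$ such that the following holds. Let $G$ be a digraph on $n\ge n_0$ vertices with outdegree sequence $d^+_1\le\dots\le d^+_n$ and indegree sequence $d^-_1\le\dots\le d^-_n$, and suppose that for all $i<n/2$: (i) $d^+_i\ge i+\eta n$ or $d^-_{n-i-\eta n}\ge n-i$, and (ii) $d^-_i\ge i+\eta n$ or $d^+_{n-i-\eta n}\ge n-i$. Then $G$ contains a Hamilton cycle.
   Context: Digraphs have no loops and at most one edge in each direction between any pair of vertices. The out- and indegree sequences are each sorted in non-decreasing order separately, so $d^+_i$ and $d^-_i$ need not be degrees of the same vertex. *)

theory Defs
  imports Complex_Main "HOL-Library.Multiset" "Graph_Theory.Arc_Walk"
begin

text \<open>The sequences are indexed from 1; \<open>outdeg_seq G i\<close> and \<open>indeg_seq G i\<close> are meaningful only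
  for \<open>1 \<le> i \<le> card (verts G)\<close>. The two sequences are sorted independently of each other.\<close>

definition outdeg_seq :: "('a, 'b) pre_digraph \<Rightarrow> nat \<Rightarrow> nat" where
  "outdeg_seq G i =
     sorted_list_of_multiset (image_mset (out_degree G) (mset_set (verts G))) ! (i - 1)"

definition indeg_seq :: "('a, 'b) pre_digraph \<Rightarrow> nat \<Rightarrow> nat" where
  "indeg_seq G i =
     sorted_list_of_multiset (image_mset (in_degree G) (mset_set (verts G))) ! (i - 1)"

text \<open>The condition that the sequence of values \<open>d\<^sub>1, d\<^sub>2, \<dots>\<close> has value at least \<open>m\<close> at the position
  \<open>x\<close>, where \<open>x\<close> need not be an integer. Positions are rounded up: for a non-decreasing sequence this
  is the weaker condition, so a theorem with it as a hypothesis implies the one with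
  rounding down. Positions that round to a non-positive number carry no entry, and the condition
  is then false.\<close>

definition seq_ge_at :: "(nat \<Rightarrow> nat) \<Rightarrow> real \<Rightarrow> nat \<Rightarrow> bool" where
  "seq_ge_at d x m \<longleftrightarrow> 1 \<le> \<lceil>x\<rceil> \<and> m \<le> d (nat \<lceil>x\<rceil>)"

definition hamilton_cycle :: "('a, 'b) pre_digraph \<Rightarrow> 'b awalk \<Rightarrow> bool" where
  "hamilton_cycle G p \<longleftrightarrow> pre_digraph.cycle G p \<and> tail G ` set p = verts G"

end

theory Submission
  imports Defs
begin

text \<open>The degree conditions make the digraph a robust expander of linear minimum semidegree: every set
  \<open>S\<close> of intermediate size has at least \<open>card S + m\<close> vertices with at least \<open>m\<close> in-neighbours in \<open>S\<close>, where
  \<open>m\<close> is linear in \<open>n\<close>. Such a digraph has a Hamilton cycle by an absorption argument that avoids the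
  regularity lemma. Expansion yields chains of bounded length between any two linear sets, with freedom to
  avoid conflicts. Applied along the predecessor map of a path system, such chains give rotations that merge a
  short path with others, so that boundedly many paths cover all vertices. For an odd number of
  edges \<open>a\<^sub>i b\<^sub>i\<close> that occur in this order on a path, with \<open>a\<^sub>i b\<^sub>i\<^sub>+\<^sub>1\<close>, \<open>x b\<^sub>1\<close> and
  \<open>a\<^sub>k y\<close> also edges, a path from \<open>y\<close> to \<open>x\<close> can be inserted without changing the ends. Greedy averaging
  gives a short cycle that can absorb any bounded number of paths; it absorbs a bounded path cover of the
  remaining vertices.\<close>

section \<open>Robust expansion\<close>

text \<open>The edges from which absorbers are made come from a path cover themselves. A bounded
  cover of all vertices has a cyclic predecessor map \<open>\<rho>\<close>, which is a bijection,
  and \<open>\<rho> b\<close> dominates \<open>b\<close> for all but boundedly many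
  \<open>b\<close>. A bijection preserves cardinalities, so the relation that joins \<open>b\<close>
  to \<open>b'\<close> when \<open>\<rho> b\<close> dominates \<open>b'\<close> expands almost as
  well as domination. One chain lemma therefore yields the rotations and also the edges between
  consecutive pairs of an absorber. Chains have a prescribed number of vertices, so the parity that
  absorbers require can be arranged. The path cover result is used twice: on the whole vertex set to
  obtain \<open>\<rho>\<close>, and on the vertices left over by the absorbing cycle. The greedy
  averaging removes a fixed proportion of the unabsorbed pairs of ends per round. Logarithmically
  many rounds would do, but a number of rounds linear in \<open>n\<close> with a small factor is
  affordable as well, and then exponential decay beats the quadratic number of pairs.\<close>

definition robust_nbhd :: "'a set \<Rightarrow> ('a \<Rightarrow> 'a \<Rightarrow> bool) \<Rightarrow> nat \<Rightarrow> 'a set \<Rightarrow> 'a set" where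
  "robust_nbhd V E m S = {v \<in> V. m \<le> card {u \<in> S. E u v}}"

text \<open>The cap \<open>card V - t\<close> makes the condition meaningful for every set of size
  at least \<open>t\<close>, so iterated neighbourhoods can be followed without an upper bound on
  their size.\<close>

definition robust_expander :: "'a set \<Rightarrow> ('a \<Rightarrow> 'a \<Rightarrow> bool) \<Rightarrow> nat \<Rightarrow> nat \<Rightarrow> bool" where
  "robust_expander V E m t \<longleftrightarrow>
     (\<forall>S\<subseteq>V. t \<le> card S \<longrightarrow> min (card S + m) (card V - t) \<le> card (robust_nbhd V E m S))"

lemma robust_expanderD:
  "robust_expander V E m t \<Longrightarrow> S \<subseteq> V \<Longrightarrow> t \<le> card S \<Longrightarrow> min (card S + m) (card V - t) \<le> card (robust_nbhd V E m S)"
  by (simp add: robust_expander_def)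

lemma robust_nbhd_subset: "robust_nbhd V E m S \<subseteq> V"
  by (auto simp: robust_nbhd_def)

lemma finite_rnbhd [simp]: "finite V \<Longrightarrow> finite (robust_nbhd V E m S)"
  by (simp add: robust_nbhd_def)

lemma robust_expander_mono:
  assumes "robust_expander V E m t" "finite V" "m' \<le> m" "t \<le> t'"
  shows "robust_expander V E m' t'"
  unfolding robust_expander_def
proof (intro allI impI)
  fix S assume S: "S \<subseteq> V" "t' \<le> card S"
  have "robust_nbhd V E m S \<subseteq> robust_nbhd V E m' S" using assms(3) by (auto simp: robust_nbhd_def)
  then have "card (robust_nbhd V E m S) \<le> card (robust_nbhd V E m' S)" using assms(2) by (intro card_mono) auto
  then show "min (card S + m') (card V - t') \<le> card (robust_nbhd V E m' S)"
    using robust_expanderD[OF assms(1) S(1)] S(2) assms(3,4) by linarith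
qed

text \<open>Since \<open>S\<close> avoids \<open>W\<close>, the counts of in-neighbours in
  \<open>S\<close> do not change; only the at most \<open>w\<close> neighbourhood vertices inside
  \<open>W\<close> are lost. If \<open>m \<le> w\<close>, the truncated \<open>m - w\<close> is 0
  and every vertex qualifies.\<close>

lemma robust_expander_delete:
  assumes "robust_expander V E m t" "finite V" "W \<subseteq> V" "card W \<le> w" 
  shows "robust_expander (V - W) E (m - w) t"
  unfolding robust_expander_def
proof (intro allI impI)
  fix S assume S: "S \<subseteq> V - W" "t \<le> card S"
  have "robust_nbhd V E m S - W \<subseteq> robust_nbhd (V - W) E (m - w) S" by (auto simp: robust_nbhd_def)
  then have "card (robust_nbhd V E m S - W) \<le> card (robust_nbhd (V - W) E (m - w) S)"
    using assms(2) by (intro card_mono) auto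
  moreover have "card (robust_nbhd V E m S) - card W \<le> card (robust_nbhd V E m S - W)"
    by (rule diff_card_le_card_Diff) (use assms finite_subset in auto)
  moreover have "min (card S + m) (card V - t) \<le> card (robust_nbhd V E m S)"
    using robust_expanderD[OF assms(1)] S by auto
  moreover have "card (V - W) = card V - card W" by (intro card_Diff_subset) (use assms finite_subset in auto)
  moreover have "w < m \<or> card (robust_nbhd (V - W) E (m - w) S) = card (V - W)"
  proof (cases "w < m")
    case False
    then have "robust_nbhd (V - W) E (m - w) S = V - W" by (auto simp: robust_nbhd_def)
    then show ?thesis by simp
  qed simp
  ultimately show "min (card S + (m - w)) (card (V - W) - t) \<le> card (robust_nbhd (V - W) E (m - w) S)"
    using assms(4) by linarith
qed

lemma robust_expander_shift:
  assumes "robust_expander V E m t" "finite V" "inj_on \<rho> V" "\<rho> ` V \<subseteq> V" "card (V - B) \<le> q" 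
  shows "robust_expander V (\<lambda>b b'. E (\<rho> b) b' \<and> b' \<in> B) (m - q) (t + q)"
  unfolding robust_expander_def
proof (intro allI impI)
  let ?D = "\<lambda>b b'. E (\<rho> b) b' \<and> b' \<in> B"
  fix S assume S: "S \<subseteq> V" "t + q \<le> card S"
  have inj: "inj_on \<rho> S" using assms(3) S(1) inj_on_subset by blast
  have card_eq: "card (\<rho> ` S) = card S" by (rule card_image[OF inj])
  have sub: "\<rho> ` S \<subseteq> V" using S(1) assms(4) by auto
  have "robust_nbhd V E m (\<rho> ` S) - (V - B) \<subseteq> robust_nbhd V ?D (m - q) S"
  proof
    fix v assume v: "v \<in> robust_nbhd V E m (\<rho> ` S) - (V - B)"
    have "{u \<in> \<rho> ` S. E u v} = \<rho> ` {u \<in> S. ?D u v}" using v by (auto simp: robust_nbhd_def)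
    then have "card {u \<in> \<rho> ` S. E u v} = card {u \<in> S. ?D u v}"
      using card_image[OF inj_on_subset[OF inj]] by auto
    then show "v \<in> robust_nbhd V ?D (m - q) S" using v by (auto simp: robust_nbhd_def)
  qed
  then have "card (robust_nbhd V E m (\<rho> ` S) - (V - B)) \<le> card (robust_nbhd V ?D (m - q) S)"
    using assms(2) by (intro card_mono) auto
  moreover have "card (robust_nbhd V E m (\<rho> ` S)) - card (V - B) \<le> card (robust_nbhd V E m (\<rho> ` S) - (V - B))"
    by (rule diff_card_le_card_Diff) (use assms in auto)
  moreover have "min (card S + m) (card V - t) \<le> card (robust_nbhd V E m (\<rho> ` S))"
    using robust_expanderD[OF assms(1) sub] S(2) card_eq by simp
  moreover have "card S \<le> card V" using S(1) assms(2) card_mono by blast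
  moreover have "q < m \<or> card (robust_nbhd V ?D (m - q) S) = card V"
  proof (cases "q < m")
    case False
    then have "robust_nbhd V ?D (m - q) S = V" by (auto simp: robust_nbhd_def)
    then show ?thesis by simp
  qed simp
  ultimately show "min (card S + (m - q)) (card V - (t + q)) \<le> card (robust_nbhd V ?D (m - q) S)"
    using assms(5) by linarith
qed

text \<open>The iterated robust neighbourhoods of \<open>S\<^sub>0\<close> grow by \<open>m\<close>
  per step, so the \<open>k\<close>-th misses at most \<open>t\<close> vertices and meets
  \<open>T\<close> in at least \<open>m\<close>. The chain is chosen backwards: each vertex has
  \<open>m\<close> predecessors in the previous layer, more than \<open>W\<close> and the conflict
  sets of the vertices already chosen can forbid.\<close>

lemma robust_expander_chain:
  assumes fin: "finite V" and robust_expander: "robust_expander V D m t" and t: "2 * t \<le> card V"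
    and S0: "S\<^sub>0 \<subseteq> V" "t \<le> card S\<^sub>0" and T: "T \<subseteq> V" "t + m \<le> card T"
    and k: "card V \<le> k * m"
    and C: "\<And>v. finite (C v)" "\<And>v. card (C v) \<le> c" and W: "finite W" "card W + (k + 1) * c < m"
  obtains xs where "length xs = Suc k" "set xs \<subseteq> V" "hd xs \<in> S\<^sub>0" "last xs \<in> T"
    "successively D xs" "sorted_wrt (\<lambda>u v. u \<notin> C v) xs" "set xs \<inter> W = {}"
proof -
  define S where "S i = (robust_nbhd V D m ^^ i) S\<^sub>0" for i
  have S_0: "S 0 = S\<^sub>0" and S_Suc: "S (Suc i) = robust_nbhd V D m (S i)" for i
    by (simp_all add: S_def)
  have S_sub: "S i \<subseteq> V" for i
    by (cases i) (simp_all add: S_0 S_Suc S0 robust_nbhd_subset)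
  have S_card: "min (t + i * m) (card V - t) \<le> card (S i)" for i
  proof (induction i)
    case 0 then show ?case using S0 by (simp add: S_0)
  next
    case (Suc i)
    have "t \<le> card (S i)" using Suc t by auto
    from robust_expanderD[OF robust_expander S_sub this] show ?case using Suc by (auto simp: S_Suc)
  qed
  \<comment> \<open>The conflict set of each chosen vertex is added to \<open>W\<close> for the rest
    of the chain. The end \<open>v\<close> is exempt (\<open>butlast\<close>) because it was tested
    when it was chosen.\<close>
  have chain: "\<exists>xs. length xs = Suc i \<and> set xs \<subseteq> V \<and> hd xs \<in> S\<^sub>0 \<and> last xs = v \<and>
      successively D xs \<and> sorted_wrt (\<lambda>u v. u \<notin> C v) xs \<and> set (butlast xs) \<inter> W = {}"
    if "v \<in> S i" "finite W" "card W + i * c < m" for i v W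
    using that
  proof (induction i arbitrary: v W)
    case 0
    then show ?case using S0 by (intro exI[of _ "[v]"]) (auto simp: S_0)
  next
    case (Suc i)
    let ?W = "W \<union> C v"
    have Wc: "card ?W \<le> card W + c"
      using card_Un_le[of W "C v"] C(2)[of v] by linarith
    have "m \<le> card {u \<in> S i. D u v}" using Suc.prems(1) by (simp add: S_Suc robust_nbhd_def)
    moreover have "card ?W < m" using Wc Suc.prems(3) by (simp add: algebra_simps)
    ultimately have "\<not> {u \<in> S i. D u v} \<subseteq> ?W"
      using card_mono[of ?W] Suc.prems(2) C(1) by (meson finite_UnI leD order_trans)
    then obtain u where u: "u \<in> S i" "D u v" "u \<notin> W" "u \<notin> C v" by auto
    have fW: "finite ?W" using Suc.prems(2) C(1) by simp
    have "card ?W + i * c < m" using Wc Suc.prems(3) by (simp add: algebra_simps)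
    from Suc.IH[OF u(1) fW this] obtain xs where
      xs: "length xs = Suc i" "set xs \<subseteq> V" "hd xs \<in> S\<^sub>0" "last xs = u"
      "successively D xs" "sorted_wrt (\<lambda>u v. u \<notin> C v) xs" "set (butlast xs) \<inter> ?W = {}" by blast
    have ne: "xs \<noteq> []" using xs(1) by auto
    have setxs: "set xs = insert u (set (butlast xs))"
      using ne xs(4) by (metis append_butlast_last_id list.simps(15) rotate1.simps(2) set_rotate1)
    have "v \<in> V" using Suc.prems(1) S_sub by blast
    show ?case
      by (rule exI[of _ "xs @ [v]"])
        (use xs u ne setxs \<open>v \<in> V\<close> in \<open>auto simp: successively_append_iff sorted_wrt_append\<close>)
  qed
  have "card V - t \<le> card (S k)" using S_card[of k] k by auto
  moreover have "card (S k \<union> T) \<le> card V" using S_sub T(1) fin by (intro card_mono) auto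
  moreover have "card (S k) + card T = card (S k \<union> T) + card (S k \<inter> T)"
    by (rule card_Un_Int) (use S_sub[of k] T(1) fin finite_subset in auto)
  ultimately have "m \<le> card (S k \<inter> T)" using T(2) t by linarith
  then have "\<not> S k \<inter> T \<subseteq> W" using W card_mono[OF W(1), of "S k \<inter> T"] by auto
  then obtain v where v: "v \<in> S k" "v \<in> T" "v \<notin> W" by auto
  have "card W + k * c < m" using W(2) by simp
  from chain[OF v(1) W(1) this] obtain xs where
    xs: "length xs = Suc k" "set xs \<subseteq> V" "hd xs \<in> S\<^sub>0" "last xs = v"
      "successively D xs" "sorted_wrt (\<lambda>u v. u \<notin> C v) xs" "set (butlast xs) \<inter> W = {}" by blast
  have "xs = butlast xs @ [v]" using xs(1,4) by (metis append_butlast_last_id length_0_conv nat.distinct(1))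
  then have "set xs = insert v (set (butlast xs))" by (metis list.simps(15) rotate1.simps(2) set_rotate1)
  then show ?thesis using that[OF xs(1,2,3) _ xs(5,6)] xs(4,7) v by auto
qed

section \<open>Path systems and rotations\<close>

text \<open>A sum of multisets states covering and disjointness in one equation, which a rotation
  preserves by mere regrouping.\<close>

definition path_cover :: "('a \<Rightarrow> 'a \<Rightarrow> bool) \<Rightarrow> 'a multiset \<Rightarrow> 'a list multiset \<Rightarrow> bool" where
  "path_cover E A F \<longleftrightarrow> (\<forall>p\<in>#F. p \<noteq> [] \<and> successively E p) \<and> (\<Sum>p\<in>#F. mset p) = A"

lemma sum_mset_mset_concat: "(\<Sum>p\<in>#mset ps. mset p) = mset (concat ps)"
  by (induction ps) auto

lemma distinct_of_mset_set: "mset xs = mset_set V \<Longrightarrow> distinct xs"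
  by (cases "finite V") (auto simp: distinct_count_atmost_1 count_mset_set' simp flip: set_mset_mset)

lemma distinct_concat_nth:
  assumes "distinct (concat ps)" "p \<in> set ps" "q \<in> set ps" "v \<in> set p" "v \<in> set q"
  shows "p = q"
  using assms by (induction ps) auto

lemma path_cover_list:
  assumes "path_cover E (mset_set V) F" "finite V"
  obtains ps where "F = mset ps" "distinct (concat ps)" "set (concat ps) = V"
    "\<And>p. p \<in> set ps \<Longrightarrow> p \<noteq> [] \<and> successively E p"
proof -
  obtain ps where ps: "mset ps = F" using ex_mset by blast
  have eq: "mset (concat ps) = mset_set V"
    using assms(1) by (simp add: path_cover_def sum_mset_mset_concat flip: ps)
  show ?thesis
  proof (rule that)
    show "distinct (concat ps)" by (rule distinct_of_mset_set[OF eq])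
    show "set (concat ps) = V" using eq assms(2) by (metis finite_set_mset_mset_set set_mset_mset)
    show "p \<noteq> [] \<and> successively E p" if "p \<in> set ps" for p
      using assms(1) that by (auto simp: path_cover_def simp flip: ps)
  qed (simp add: ps)
qed

section \<open>Cyclic predecessor maps and rotations\<close>

lemma map_exists:
  "distinct xs \<Longrightarrow> length xs = length ys \<Longrightarrow> \<exists>f. map f xs = ys"
proof (induction xs arbitrary: ys)
  case (Cons x xs)
  then obtain y ys' where ys: "ys = y # ys'" by (cases ys) auto
  with Cons obtain f where "map f xs = ys'" by auto
  then have "map (f(x := y)) (x # xs) = ys" using Cons.prems(1) ys by (auto intro!: map_cong)
  then show ?case by blast
qed simp

lemma map_concat_eq:
  assumes "map f (concat ps) = concat (map g ps)" "\<And>p. p \<in> set ps \<Longrightarrow> length (g p) = length p"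
    and "p \<in> set ps"
  shows "map f p = g p"
  using assms by (induction ps) auto

text \<open>Rotating every path by one place only permutes \<open>concat ps\<close>; matching the
  two lists position by position defines \<open>\<rho>\<close>. Sending the first vertex of a path
  to its last one is what makes \<open>\<rho>\<close> a bijection.\<close>

lemma cyclic_pred_exists:
  assumes "distinct (concat ps)" "\<And>p. p \<in> set ps \<Longrightarrow> p \<noteq> []"
  obtains \<rho> where "bij_betw \<rho> (set (concat ps)) (set (concat ps))"
    "\<And>p ys b zs. p \<in> set ps \<Longrightarrow> p = ys @ b # zs \<Longrightarrow> \<rho> b = (if ys = [] then last p else last ys)"
proof -
  let ?rot = "\<lambda>p. last p # butlast p"
  have rot_mset: "mset (?rot p) = mset p" if "p \<noteq> []" for p :: "'a list"
    using that by (metis append_butlast_last_id mset.simps(2) union_code mset_append add_mset_add_single mset_single_iff_right)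
  have mset_eq: "mset (concat (map ?rot ps)) = mset (concat ps)"
    using assms(2)
  proof (induction ps)
    case (Cons p ps)
    have "mset (concat (map ?rot (p # ps))) = mset (?rot p) + mset (concat (map ?rot ps))" by simp
    also have "\<dots> = mset p + mset (concat ps)"
      using Cons.IH Cons.prems rot_mset[of p] by (metis list.set_intros)
    finally show ?case by simp
  qed simp
  then have len: "length (concat ps) = length (concat (map ?rot ps))" by (metis size_mset)
  obtain \<rho> where \<rho>: "map \<rho> (concat ps) = concat (map ?rot ps)"
    using map_exists[OF assms(1) len] by blast
  have "set (concat (map ?rot ps)) = set (concat ps)" by (metis mset_eq set_mset_mset)
  then have img: "\<rho> ` set (concat ps) = set (concat ps)" by (metis \<rho> set_map)
  have "distinct (map \<rho> (concat ps))" using assms(1) mset_eq \<rho> by (metis mset_eq_imp_distinct_iff)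
  then have inj: "inj_on \<rho> (set (concat ps))" by (simp add: distinct_map)
  show ?thesis
  proof (rule that)
    show "bij_betw \<rho> (set (concat ps)) (set (concat ps))" using inj img by (simp add: bij_betw_def)
    fix p ys b zs assume p: "p \<in> set ps" "p = ys @ b # zs"
    have "map \<rho> p = ?rot p"
      by (rule map_concat_eq[OF \<rho> _ p(1)]) (use assms(2) in auto)
    then have "\<rho> b = ?rot p ! length ys"
      using p(2) by (metis length_append length_Cons less_add_Suc1 add_Suc_right nth_append_length nth_map)
    also have "\<dots> = (if ys = [] then last p else last ys)"
      using p(2) by (cases ys rule: rev_cases) (auto simp: nth_append butlast_append)
    finally show "\<rho> b = (if ys = [] then last p else last ys)" .
  qed
qed

fun linked :: "('a \<Rightarrow> 'a \<Rightarrow> bool) \<Rightarrow> 'a \<Rightarrow> ('a list \<times> 'a list) list \<Rightarrow> 'a \<Rightarrow> bool" where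
  "linked E u [] s \<longleftrightarrow> E u s"
| "linked E u ((ys, zs) # sp) s \<longleftrightarrow>
     E u (hd zs) \<and> linked E (last (if ys = [] then zs else ys)) sp s"

text \<open>The path \<open>X\<close> is continued at the second part \<open>zs\<close> of the next path \<open>ys @ zs\<close>; the result is
  put aside and \<open>ys\<close> takes the role of \<open>X\<close>. Since the weight of \<open>X\<close> itself is never counted, only the
  ends \<open>zs\<close> that are split off must not be too short. If \<open>ys\<close> is empty, nothing is split off and \<open>X\<close>
  just swallows the path; this is why predecessors are closed up cyclically.\<close>

lemma rotation:
  fixes f :: "nat \<Rightarrow> nat"
  assumes "antimono f" "Q \<noteq> []" "successively E Q"
    and "X \<noteq> []" "successively E X" "linked E (last X) sp (hd Q)"
    and "\<And>ys zs. (ys, zs) \<in> set sp \<Longrightarrow>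
      zs \<noteq> [] \<and> successively E (ys @ zs) \<and> f (length zs) \<le> Suc (f (length (ys @ zs)))"
  shows "\<exists>F. path_cover E (mset X + mset Q + mset (concat (map (\<lambda>(ys, zs). ys @ zs) sp))) F \<and>
    (\<Sum>p\<in>#F. f (length p)) \<le> f (length Q) + (\<Sum>(ys, zs)\<leftarrow>sp. f (length (ys @ zs))) + length sp"
  using assms(4-)
proof (induction sp arbitrary: X)
  case Nil
  have "f (length (X @ Q)) \<le> f (length Q)" using assms(1) by (simp add: antimonoD)
  then show ?case using Nil assms(2,3)
    by (intro exI[of _ "{#X @ Q#}"]) (auto simp: path_cover_def successively_append_iff)
next
  case (Cons s sp)
  obtain ys zs where s: "s = (ys, zs)" by fastforce
  have zs: "zs \<noteq> []" "successively E (ys @ zs)" "f (length zs) \<le> Suc (f (length (ys @ zs)))"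
    using Cons.prems(4)[of ys zs] by (auto simp: s)
  have zs': "successively E zs" using zs(2) by (simp add: successively_append_iff)
  have Xzs: "successively E (X @ zs)" using Cons.prems zs' by (auto simp: s successively_append_iff)
  have sp: "\<And>ys zs. (ys, zs) \<in> set sp \<Longrightarrow>
      zs \<noteq> [] \<and> successively E (ys @ zs) \<and> f (length zs) \<le> Suc (f (length (ys @ zs)))"
    by (rule Cons.prems(4)[OF list.set_intros(2)])
  show ?case
  proof (cases "ys = []")
    case True
    have "linked E (last (X @ zs)) sp (hd Q)" using Cons.prems(3) zs(1) by (simp add: s True)
    then obtain F where "path_cover E (mset (X @ zs) + mset Q + mset (concat (map (\<lambda>(ys, zs). ys @ zs) sp))) F"
      "(\<Sum>p\<in>#F. f (length p)) \<le> f (length Q) + (\<Sum>(ys, zs)\<leftarrow>sp. f (length (ys @ zs))) + length sp"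
      using Cons.IH[OF _ Xzs _ sp] Cons.prems(1) by blast
    then show ?thesis by (intro exI[of _ F]) (auto simp: s True ac_simps)
  next
    case False
    have "linked E (last ys) sp (hd Q)" "successively E ys"
      using Cons.prems(3) zs(2) by (simp_all add: s False successively_append_iff)
    then obtain F where F: "path_cover E (mset ys + mset Q + mset (concat (map (\<lambda>(ys, zs). ys @ zs) sp))) F"
      "(\<Sum>p\<in>#F. f (length p)) \<le> f (length Q) + (\<Sum>(ys, zs)\<leftarrow>sp. f (length (ys @ zs))) + length sp"
      using Cons.IH[OF False _ _ sp] by blast
    have "f (length (X @ zs)) \<le> f (length zs)" using assms(1) by (simp add: antimonoD)
    then show ?thesis using F zs(3) Xzs Cons.prems(1)
      by (intro exI[of _ "add_mset (X @ zs) F"]) (auto simp: s path_cover_def ac_simps)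
  qed
qed

text \<open>Splitting a path at such a vertex \<open>b\<close> leaves at least a fraction
  \<open>1 / h\<close> of it from \<open>b\<close> on, so the split is cheap in weight.\<close>

definition deep :: "nat \<Rightarrow> 'a list list \<Rightarrow> 'a set" where
  "deep h ps = {b. \<exists>p\<in>set ps. \<exists>ys zs. p = ys @ b # zs \<and> length p \<le> h * length (b # zs)}"

text \<open>On each path \<open>p\<close> only the last \<open>length p div h\<close> vertices can
  fail.\<close>

lemma card_not_deep:
  "h * card (set (concat ps) - deep h ps) \<le> length (concat ps)"
proof (cases "h = 0")
  case False
  show ?thesis
  proof (induction ps)
    case (Cons p ps)
    let ?D = "set (drop (length p - length p div h) p)"
    have "set p - deep h (p # ps) \<subseteq> ?D"
    proof
      fix b assume b: "b \<in> set p - deep h (p # ps)"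
      then obtain ys zs where p: "p = ys @ b # zs" by (meson DiffD1 split_list)
      with b have "\<not> length p \<le> h * length (b # zs)" by (auto simp: deep_def)
      then have "h * length (b # zs) \<le> length p" by simp
      then have "length (b # zs) \<le> length p div h"
        using False by (metis div_le_mono nonzero_mult_div_cancel_left)
      then show "b \<in> ?D" by (auto simp: p)
    qed
    then have "set (concat (p # ps)) - deep h (p # ps) \<subseteq> ?D \<union> (set (concat ps) - deep h ps)"
      by (auto simp: deep_def)
    then have "card (set (concat (p # ps)) - deep h (p # ps)) \<le> card (?D \<union> (set (concat ps) - deep h ps))"
      by (intro card_mono) auto
    also have "\<dots> \<le> card ?D + card (set (concat ps) - deep h ps)" by (rule card_Un_le)
    also have "card ?D \<le> length p div h" using card_length[of "drop (length p - length p div h) p"] by simp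
    finally have "h * card (set (concat (p # ps)) - deep h (p # ps))
        \<le> h * (length p div h) + h * card (set (concat ps) - deep h ps)"
      by (simp flip: distrib_left)
    also have "\<dots> \<le> length p + length (concat ps)" by (intro add_mono Cons) simp
    finally show ?case by simp
  qed simp
qed simp

text \<open>Turns a chain of the shifted relation into input for a rotation. After a path is split
  at \<open>b\<close>, the free end is \<open>\<rho> b\<close>; by the cyclic convention this also
  holds when the whole path is swallowed.\<close>

lemma linked_map:
  assumes "bs \<noteq> []" "E u (hd bs)" "successively (\<lambda>b b'. E (\<rho> b) b') bs" "E (\<rho> (last bs)) s"
    and "\<And>b. b \<in> set bs \<Longrightarrow> hd (snd (sel b)) = b"
    and "\<And>b. b \<in> set bs \<Longrightarrow> last (if fst (sel b) = [] then snd (sel b) else fst (sel b)) = \<rho> b"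
  shows "linked E u (map sel bs) s"
  using assms
proof (induction bs arbitrary: u)
  case (Cons b bs)
  obtain ys zs where sel: "sel b = (ys, zs)" by fastforce
  have b: "hd zs = b" "last (if ys = [] then zs else ys) = \<rho> b"
    using Cons.prems(5)[of b] Cons.prems(6)[of b] unfolding sel fst_conv snd_conv by (simp, auto)
  show ?case
  proof (cases "bs = []")
    case True
    then show ?thesis using Cons.prems b by (simp add: sel)
  next
    case False
    have "linked E (\<rho> b) (map sel bs) s"
      by (rule Cons.IH) (use Cons.prems False in \<open>auto simp: successively_Cons\<close>)
    then show ?thesis using Cons.prems(2) b by (simp add: sel)
  qed
qed simp

lemma mset_distinct_subset:
  assumes "distinct qs" "set qs \<subseteq> set ps"
  shows "mset qs \<subseteq># mset ps"
proof (rule mset_subset_eqI)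
  fix a show "count (mset qs) a \<le> count (mset ps) a"
    using assms by (cases "a \<in> set qs") (auto simp: distinct_count_atmost_1 Suc_le_eq count_eq_zero_iff)
qed

text \<open>The short path \<open>P\<close> is rotated into \<open>Q\<close> along a chain from
  \<open>last P\<close> to \<open>hd Q\<close>. Using the whole path through a vertex as its
  conflict set makes the chain meet each path at most once. The \<open>k + 1\<close> splits cost at
  most \<open>k + 1\<close>, less than the weight of \<open>P\<close>, which is no longer
  counted.\<close>

lemma path_cover_improve:
  fixes f :: "nat \<Rightarrow> nat"
  assumes fin: "finite V" and F: "path_cover E (mset_set V) F" and PQ: "P \<in># F" "Q \<in># F" "P \<noteq> Q"
    and len: "\<And>p. p \<in># F \<Longrightarrow> length p \<le> c"
    and robust_expander: "robust_expander V E (m + q) t"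
    and out: "\<And>v. v \<in> V \<Longrightarrow> d \<le> card {u \<in> V. E v u}" and inn: "\<And>v. v \<in> V \<Longrightarrow> d \<le> card {u \<in> V. E u v}"
    and d: "t + 2 * q + m \<le> d" and t: "2 * (t + q) \<le> card V"
    and h: "card V \<le> h * q" and k: "card V \<le> k * m" and c: "(k + 3) * c < m"
    and f: "antimono f" "\<And>x y. y \<le> x \<Longrightarrow> x \<le> h * y \<Longrightarrow> f y \<le> Suc (f x)"
    and P: "Suc k < f (length P)"
  shows "\<exists>F'. path_cover E (mset_set V) F' \<and> (\<Sum>p\<in>#F'. f (length p)) < (\<Sum>p\<in>#F. f (length p))"
proof -
  obtain ps where ps: "F = mset ps" "distinct (concat ps)" "set (concat ps) = V"
    "\<And>p. p \<in> set ps \<Longrightarrow> p \<noteq> [] \<and> successively E p"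
    using path_cover_list[OF F fin] by blast
  obtain \<rho> where \<rho>: "bij_betw \<rho> V V"
    "\<And>p ys b zs. p \<in> set ps \<Longrightarrow> p = ys @ b # zs \<Longrightarrow> \<rho> b = (if ys = [] then last p else last ys)"
    using cyclic_pred_exists[OF ps(2)] ps(3,4) by metis
  have P': "P \<in> set ps" "P \<noteq> []" "successively E P" and Q': "Q \<in> set ps" "Q \<noteq> []" "successively E Q"
    using PQ ps(1,4) by auto
  have PV: "last P \<in> V" "hd Q \<in> V" using P' Q' ps(3) by auto
  define B where "B = deep h ps"
  have "V \<noteq> {}" using PV by auto
  then have h0: "h > 0" using h fin by (cases h) auto
  have "length (concat ps) = card V" using ps(2,3) distinct_card by metis
  then have "h * card (V - B) \<le> h * q"
    using card_not_deep[of h ps] h unfolding ps(3) B_def by linarith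
  then have cB: "card (V - B) \<le> q" using h0 by simp
  define D where "D = (\<lambda>b b'. E (\<rho> b) b' \<and> b' \<in> B)"
  have \<rho>V: "inj_on \<rho> V" "\<rho> ` V = V" using \<rho>(1) by (auto simp: bij_betw_def)
  have rD: "robust_expander V D m (t + q)"
    using robust_expander_shift[OF robust_expander fin \<rho>V(1) _ cB] \<rho>V(2) unfolding D_def by simp
  define C where "C v = \<Union>{set p |p. p \<in> set ps \<and> v \<in> set p}" for v
  have C_eq: "C v = set p" if "p \<in> set ps" "v \<in> set p" for v p
    using distinct_concat_nth[OF ps(2)] that unfolding C_def by blast
  have C0: "C v = {}" if "v \<notin> V" for v using that ps(3) by (auto simp: C_def)
  have C: "finite (C v) \<and> card (C v) \<le> c" for v
  proof (cases "v \<in> V")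
    case True
    then obtain p where p: "p \<in> set ps" "v \<in> set p" using ps(3) by auto
    have "card (set p) \<le> c" using len[of p] p(1) ps(1) card_length[of p] by auto
    then show ?thesis using C_eq[OF p] by simp
  qed (simp add: C0)
  define S0 where "S0 = {b \<in> V. E (last P) b} \<inter> B"
  define T where "T = {b \<in> V. E (\<rho> b) (hd Q)}"
  have "d \<le> card {b \<in> V. E (last P) b}" using out PV by blast
  also have "\<dots> \<le> card (S0 \<union> (V - B))" by (intro card_mono) (auto simp: S0_def fin)
  also have "\<dots> \<le> card S0 + card (V - B)" by (rule card_Un_le)
  finally have S0: "t + q \<le> card S0" using cB d by linarith
  have "{u \<in> V. E u (hd Q)} = \<rho> ` T"
    unfolding T_def by (subst (1) \<rho>V(2)[symmetric]) auto
  then have "card {u \<in> V. E u (hd Q)} = card T"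
    using card_image[OF inj_on_subset[OF \<rho>V(1), of T]] by (auto simp: T_def)
  then have T: "t + q + m \<le> card T" using inn[OF PV(2)] d by linarith
  \<comment> \<open>Barring \<open>P\<close> and \<open>Q\<close> takes \<open>2 * c\<close> out of
    the budget \<open>(k + 3) * c\<close>.\<close>
  let ?W = "set P \<union> set Q"
  have "card ?W \<le> length P + length Q"
    using card_Un_le[of "set P" "set Q"] card_length[of P] card_length[of Q] by linarith
  then have "card ?W \<le> 2 * c" using len[OF PQ(1)] len[OF PQ(2)] by linarith
  then have W: "card ?W + (k + 1) * c < m" using c by (simp add: algebra_simps)
  obtain bs where bs: "length bs = Suc k" "set bs \<subseteq> V" "hd bs \<in> S0" "last bs \<in> T"
    "successively D bs" "sorted_wrt (\<lambda>u v. u \<notin> C v) bs" "set bs \<inter> ?W = {}"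
    by (rule robust_expander_chain[OF fin rD t, of S0 T k C c ?W]) (use S0 T C k W in \<open>auto simp: S0_def T_def\<close>)
  have bs_ne: "bs \<noteq> []" using bs(1) by auto
  have bsB: "set bs \<subseteq> B"
  proof -
    have "set xs \<subseteq> B" if "successively D xs" "xs \<noteq> []" "hd xs \<in> B" for xs
      using that by (induction xs) (auto simp: successively_Cons D_def, metis empty_iff list.set(1) subsetD)
    then show ?thesis using bs(3,5) bs_ne by (auto simp: S0_def)
  qed
  have "\<forall>b\<in>B. \<exists>s. fst s @ snd s \<in> set ps \<and> snd s \<noteq> [] \<and> hd (snd s) = b
      \<and> length (fst s @ snd s) \<le> h * length (snd s)"
  proof
    fix b assume "b \<in> B"
    then obtain p ys zs where "p \<in> set ps" "p = ys @ b # zs" "length p \<le> h * length (b # zs)"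
      by (auto simp: B_def deep_def)
    then show "\<exists>s. fst s @ snd s \<in> set ps \<and> snd s \<noteq> [] \<and> hd (snd s) = b
      \<and> length (fst s @ snd s) \<le> h * length (snd s)" by (intro exI[of _ "(ys, b # zs)"]) auto
  qed
  then obtain sel where sel: "\<And>b. b \<in> B \<Longrightarrow> fst (sel b) @ snd (sel b) \<in> set ps"
    "\<And>b. b \<in> B \<Longrightarrow> snd (sel b) \<noteq> []" "\<And>b. b \<in> B \<Longrightarrow> hd (snd (sel b)) = b"
    "\<And>b. b \<in> B \<Longrightarrow> length (fst (sel b) @ snd (sel b)) \<le> h * length (snd (sel b))"
    by metis
  have sel_\<rho>: "last (if fst (sel b) = [] then snd (sel b) else fst (sel b)) = \<rho> b" if "b \<in> B" for b
  proof -
    have "fst (sel b) @ snd (sel b) = fst (sel b) @ b # tl (snd (sel b))"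
      using sel(2,3)[OF that] by (metis list.collapse)
    from \<rho>(2)[OF sel(1)[OF that] this] show ?thesis by auto
  qed
  have linked: "linked E (last P) (map sel bs) (hd Q)"
  proof (rule linked_map[OF bs_ne, of _ _ \<rho>])
    show "successively (\<lambda>b. E (\<rho> b)) bs" by (rule successively_mono[OF bs(5)]) (simp add: D_def)
  qed (use bs bsB sel(3) sel_\<rho> in \<open>auto simp only: S0_def T_def\<close>)
  define piece where "piece b = fst (sel b) @ snd (sel b)" for b
  define qs where "qs = map piece bs"
  have piece: "piece b \<in> set ps" "b \<in> set (piece b)" if "b \<in> B" for b
    using sel(1-3)[OF that] by (auto simp: piece_def) (metis hd_in_set)
  have "distinct qs"
  proof -
    have "sorted_wrt (\<lambda>u v. piece u \<noteq> piece v) bs"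
    proof (rule sorted_wrt_mono_rel[OF _ bs(6)])
      fix u v assume "u \<in> set bs" "v \<in> set bs" "u \<notin> C v"
      then show "piece u \<noteq> piece v" using piece C_eq bsB by (metis subsetD)
    qed
    then show ?thesis unfolding qs_def distinct_conv_nth by (simp add: sorted_wrt_iff_nth_less)
        (metis nat_neq_iff)
  qed
  moreover have "P \<notin> set qs" "Q \<notin> set qs"
    using bs(7) piece bsB by (auto simp: qs_def)
  ultimately have "distinct (P # Q # qs)" using PQ(3) by simp
  moreover have "set (P # Q # qs) \<subseteq> set ps" using P' Q' piece bsB by (auto simp: qs_def)
  ultimately obtain G where G: "F = mset (P # Q # qs) + G"
    using mset_distinct_subset ps(1) by (metis subset_mset.le_iff_add)
  have sp: "zs \<noteq> [] \<and> successively E (ys @ zs) \<and> f (length zs) \<le> Suc (f (length (ys @ zs)))"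
    if "(ys, zs) \<in> set (map sel bs)" for ys zs
  proof -
    obtain b where b: "b \<in> B" "sel b = (ys, zs)" using \<open>(ys, zs) \<in> _\<close> bsB by auto
    have "f (length zs) \<le> Suc (f (length (ys @ zs)))"
      by (rule f(2)) (use sel(4)[OF b(1)] b(2) in auto)
    then show ?thesis using sel(1,2)[OF b(1)] ps(4) b(2) by auto
  qed
  obtain F1 where F1: "path_cover E (mset P + mset Q + mset (concat (map (\<lambda>(ys, zs). ys @ zs) (map sel bs)))) F1"
    "(\<Sum>p\<in>#F1. f (length p)) \<le> f (length Q) + (\<Sum>(ys, zs)\<leftarrow>map sel bs. f (length (ys @ zs))) + length (map sel bs)"
    using rotation[OF f(1) Q'(2,3) P'(2,3) linked sp] by blast
  have qs1: "map (\<lambda>(ys, zs). ys @ zs) (map sel bs) = qs"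
    and qs2: "(\<Sum>(ys, zs)\<leftarrow>map sel bs. f (length (ys @ zs))) = (\<Sum>p\<in>#mset qs. f (length p))"
    by (auto simp: qs_def piece_def split_beta o_def sum_mset_sum_list simp flip: mset_map)
  have sumG: "(\<Sum>p\<in>#F. mset p) = mset P + mset Q + mset (concat qs) + (\<Sum>p\<in>#G. mset p)"
    by (simp add: G flip: sum_mset_mset_concat)
  have "path_cover E (mset_set V) (F1 + G)"
    using F1(1)[unfolded qs1] F sumG by (auto simp: path_cover_def G)
  moreover have "(\<Sum>p\<in>#F1 + G. f (length p)) < (\<Sum>p\<in>#F. f (length p))"
    using F1(2) P bs(1) unfolding qs2 by (simp add: G)
  ultimately show ?thesis by blast
qed

section \<open>Covers by boundedly many paths\<close>

lemma path_cover_singletons: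
  "finite V \<Longrightarrow> path_cover E (mset_set V) (image_mset (\<lambda>v. [v]) (mset_set V))"
  by (auto simp: path_cover_def image_mset.compositionality o_def)

lemma sum_length_path_cover: "path_cover E A F \<Longrightarrow> (\<Sum>p\<in>#F. length p) = size A"
proof -
  have "size (\<Sum>p\<in>#F. mset p) = (\<Sum>p\<in>#F. length p)" by (induction F) auto
  then show "path_cover E A F \<Longrightarrow> (\<Sum>p\<in>#F. length p) = size A" by (simp add: path_cover_def)
qed

text \<open>The weight \<open>f x\<close> counts the scales \<open>h ^ r * L\<close> above \<open>x\<close>: keeping a fraction \<open>1 / h\<close> of a path costs
  at most 1, so a rotation with \<open>k + 1\<close> splits costs at most \<open>k + 1\<close>, less than the weight \<open>k + 2\<close> of a path
  below all scales. Paths above all scales have weight 0 and may be cut for free, which keeps the paths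
  short enough for a chain to meet each of them at most once.\<close>

lemma path_cover_exists:
  assumes fin: "finite V" "V \<noteq> {}"
    and robust_expander: "robust_expander V E (m + q) t"
    and out: "\<And>v. v \<in> V \<Longrightarrow> d \<le> card {u \<in> V. E v u}" and inn: "\<And>v. v \<in> V \<Longrightarrow> d \<le> card {u \<in> V. E u v}"
    and d: "t + 2 * q + m \<le> d" and t: "2 * (t + q) \<le> card V"
    and h: "card V \<le> h * q" and k: "card V \<le> k * m"
    and L: "L > 0" "(k + 3) * (2 * h ^ (k + 2) * L) < m"
  obtains F where "path_cover E (mset_set V) F" "size F * (h * L) \<le> card V \<or> size F = 1"
proof -
  have h0: "h > 0" using h fin by (cases h) auto
  define M where "M = h ^ (k + 2) * L"
  have M: "M > 0" using h0 L by (simp add: M_def)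
  define f where "f x = card {r \<in> {1..k + 2}. x < h ^ r * L}" for x
  have anti: "antimono f"
    unfolding f_def by (intro antimonoI card_mono) auto
  have f_step: "f y \<le> Suc (f x)" if "y \<le> x" "x \<le> h * y" for x y
  proof -
    let ?A = "{r \<in> {1..k + 2}. y < h ^ r * L}"
    \<comment> \<open>A scale above \<open>y\<close>, moved up by one, is above \<open>x\<close>
      since \<open>x \<le> h * y\<close>. Only the top scale has no successor, which accounts for
      the \<open>Suc\<close>.\<close>
    have "Suc ` (?A - {k + 2}) \<subseteq> {r \<in> {1..k + 2}. x < h ^ r * L}"
    proof (rule image_subsetI)
      fix r assume r: "r \<in> ?A - {k + 2}"
      then have "h * y < h * (h ^ r * L)" using h0 by simp
      with that(2) have "x < h * (h ^ r * L)" by linarith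
      then show "Suc r \<in> {r \<in> {1..k + 2}. x < h ^ r * L}" using r by (auto simp: mult.assoc)
    qed
    then have "card (Suc ` (?A - {k + 2})) \<le> f x" unfolding f_def by (intro card_mono) auto
    then have "card (?A - {k + 2}) \<le> f x" by (simp add: card_image)
    moreover have "f y - 1 \<le> card (?A - {k + 2})"
      using diff_card_le_card_Diff[of "{k + 2}" ?A] by (simp add: f_def)
    ultimately show ?thesis by linarith
  qed
  have f_zero: "f x = 0" if "M \<le> x" for x
  proof -
    have "h ^ r * L \<le> x" if "r \<le> k + 2" for r
      using power_increasing[OF that, of h] h0 \<open>M \<le> x\<close> by (metis M_def Suc_leI One_nat_def mult_le_mono1 order_trans)
    then have "{r \<in> {1..k + 2}. x < h ^ r * L} = {}" by (auto simp: leD)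
    then show ?thesis by (simp add: f_def)
  qed
  have f_big: "f x = k + 2" if "x < h * L" for x
  proof -
    have "x < h ^ r * L" if "1 \<le> r" for r
      using power_increasing[OF that, of h] h0 \<open>x < h * L\<close>
      by (metis Suc_leI One_nat_def mult_le_mono1 power_one_right order_less_le_trans)
    then have "{r \<in> {1..k + 2}. x < h ^ r * L} = {1..k + 2}" by auto
    then show ?thesis by (simp add: f_def)
  qed
  define \<Phi> where "\<Phi> F = (\<Sum>p\<in>#F. f (length p))" for F :: "'a list multiset"
  define N where "N = card V"
  \<comment> \<open>A lexicographic order: \<open>N - size F\<close> is at most \<open>N\<close>, so
    a minimiser of \<open>g\<close> minimises \<open>\<Phi>\<close> and, among such covers, has the
    most paths.\<close>
  define g where "g F = \<Phi> F * Suc N + (N - size F)" for F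
  have sizeN: "size F \<le> N" if "path_cover E (mset_set V) F" for F
  proof -
    have "(\<Sum>p\<in>#F. 1) \<le> (\<Sum>p\<in>#F. length p)"
      using that by (intro sum_mset_mono) (auto simp: path_cover_def Suc_le_eq)
    then show ?thesis using sum_length_path_cover[OF that] by (simp add: N_def)
  qed
  obtain F where F: "path_cover E (mset_set V) F"
    and least: "\<And>F'. path_cover E (mset_set V) F' \<Longrightarrow> g F \<le> g F'"
    using ex_has_least_nat[of "path_cover E (mset_set V)", OF path_cover_singletons[OF fin(1)], of g] by blast
  have min\<Phi>: "\<Phi> F \<le> \<Phi> F'" if "path_cover E (mset_set V) F'" for F'
  proof (rule ccontr)
    assume "\<not> \<Phi> F \<le> \<Phi> F'"
    then have "Suc (\<Phi> F') * Suc N \<le> \<Phi> F * Suc N" by (intro mult_le_mono1) simp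
    then show False using least[OF that] by (simp add: g_def)
  qed
  \<comment> \<open>A path longer than \<open>2 * M\<close> can be cut into two parts of weight 0.
    This keeps \<open>\<Phi>\<close> and adds a path, against the choice of
    \<open>F\<close>.\<close>
  have short: "length p \<le> 2 * M" if p: "p \<in># F" for p
  proof (rule ccontr)
    assume *: "\<not> length p \<le> 2 * M"
    obtain G where G: "F = add_mset p G" using p by (metis insert_DiffM)
    let ?F = "add_mset (take M p) (add_mset (drop M p) G)"
    have pp: "p \<noteq> []" "successively E p" using F p by (auto simp: path_cover_def)
    have "successively E (take M p @ drop M p)" using pp by simp
    then have "successively E (take M p)" "successively E (drop M p)" by (simp_all only: successively_append_iff)
    moreover have "mset (take M p) + mset (drop M p) = mset p" by (metis append_take_drop_id mset_append)
    ultimately have F': "path_cover E (mset_set V) ?F"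
      using F * M pp by (auto simp: path_cover_def G simp flip: add.assoc)
    have "\<Phi> ?F = \<Phi> F" using * by (simp add: \<Phi>_def G f_zero)
    then show False using least[OF F'] sizeN[OF F'] by (simp add: g_def G)
  qed
  have "size F \<noteq> 0" using F fin by (auto simp: path_cover_def mset_set_empty_iff)
  moreover have "size F * (h * L) \<le> card V" if "2 \<le> size F"
  proof -
    have long: "h * L \<le> length P" if P: "P \<in># F" for P
    proof (rule ccontr)
      assume *: "\<not> h * L \<le> length P"
      obtain ps where ps: "F = mset ps" "distinct (concat ps)" "\<And>p. p \<in> set ps \<Longrightarrow> p \<noteq> []"
        using path_cover_list[OF F fin(1)] by metis
      have "distinct ps" using ps(2,3) by (simp add: distinct_concat_iff) (metis removeAll_id)
      then have "2 \<le> card (set ps)" using \<open>2 \<le> size F\<close> ps(1) by (simp add: distinct_card)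
      then have "\<not> set ps \<subseteq> {P}" using card_mono[of "{P}" "set ps"] by auto
      then obtain Q where Q: "Q \<in># F" "P \<noteq> Q" using ps(1) by auto
      have "Suc k < f (length P)" using f_big * by simp
      moreover have "(k + 3) * (2 * M) < m" using L(2) by (simp add: M_def mult.assoc)
      ultimately obtain F' where "path_cover E (mset_set V) F'" "\<Phi> F' < \<Phi> F"
        using path_cover_improve[OF fin(1) F P Q(1,2) short robust_expander out inn d t h k _ anti f_step]
        unfolding \<Phi>_def by blast
      then show False using min\<Phi> by fastforce
    qed
    have "(\<Sum>p\<in>#F. h * L) \<le> (\<Sum>p\<in>#F. length p)" by (intro sum_mset_mono long)
    then show ?thesis using sum_length_path_cover[OF F] by simp
  qed
  ultimately show ?thesis using that[OF F] by linarith
qed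

section \<open>Absorbing paths\<close>

text \<open>Only the ends of \<open>Q\<close> decide whether it can be inserted; a pair in
  \<open>U\<close> lists the last vertex first. Equality of multisets lets insertions be composed
  before disjointness is considered.\<close>

definition absorbs :: "('a \<Rightarrow> 'a \<Rightarrow> bool) \<Rightarrow> 'a list \<Rightarrow> ('a \<times> 'a) set \<Rightarrow> bool" where
  "absorbs E P U \<longleftrightarrow> (\<forall>Q. Q \<noteq> [] \<longrightarrow> successively E Q \<longrightarrow> (last Q, hd Q) \<in> U \<longrightarrow>
     (\<exists>P'. P' \<noteq> [] \<and> successively E P' \<and> hd P' = hd P \<and> last P' = last P \<and> mset P' = mset P + mset Q))"

text \<open>Here \<open>s\<close> is the end of the growing front part, while \<open>x\<close> and
  \<open>y\<close> are the last and first vertices of the path still to be inserted. Each step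
  consumes two segments and the empty list fails, so the number of segments is odd.\<close>

fun weavable :: "('a \<Rightarrow> 'a \<Rightarrow> bool) \<Rightarrow> 'a \<Rightarrow> 'a \<Rightarrow> 'a \<Rightarrow> 'a list list \<Rightarrow> bool" where
  "weavable E s x y [] \<longleftrightarrow> False"
| "weavable E s x y [A] \<longleftrightarrow> E s y \<and> E x (hd A)"
| "weavable E s x y (A # B # Ss) \<longleftrightarrow> E x (hd A) \<and> E s (hd B) \<and> weavable E (last B) (last A) y Ss"

text \<open>The absorbed path \<open>S\<^sub>0 S\<^sub>2 S\<^sub>4 \<dots> Q S\<^sub>1 S\<^sub>3 \<dots>\<close> is built by moving \<open>S\<^sub>1\<close> to the end of \<open>Q\<close> and
  appending \<open>S\<^sub>2\<close> to \<open>S\<^sub>0\<close>.\<close>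

lemma weave:
  assumes "weavable E (last S) (last Q) (hd Q) Ss" "S \<noteq> []" "successively E S" "Q \<noteq> []" "successively E Q"
    and "\<And>A. A \<in> set Ss \<Longrightarrow> A \<noteq> [] \<and> successively E A"
  shows "\<exists>P. P \<noteq> [] \<and> successively E P \<and> hd P = hd S \<and> last P = last (last Ss) \<and>
    mset P = mset S + mset Q + mset (concat Ss)"
  using assms
proof (induction Ss arbitrary: S Q rule: induct_list012)
  case (2 A)
  then show ?case by (intro exI[of _ "S @ Q @ A"]) (auto simp: successively_append_iff)
next
  case (3 A B Ss)
  have AB: "A \<noteq> []" "successively E A" "B \<noteq> []" "successively E B" using "3.prems"(6) by auto
  have "\<exists>P. P \<noteq> [] \<and> successively E P \<and> hd P = hd (S @ B) \<and> last P = last (last Ss) \<and>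
    mset P = mset (S @ B) + mset (Q @ A) + mset (concat Ss)"
    by (rule "3.IH"(1)) (use "3.prems" AB in \<open>auto simp: successively_append_iff\<close>)
  moreover have "Ss \<noteq> []" using "3.prems"(1) by auto
  ultimately show ?case using "3.prems"(2) by (auto simp: ac_simps)
qed simp

text \<open>With \<open>a\<^sub>i = \<rho> b\<^sub>i\<close>, the path through
  \<open>a\<^sub>1 b\<^sub>1\<close>, then \<open>a\<^sub>2 b\<^sub>2\<close>, and so on is cut
  after every \<open>a\<^sub>i\<close>: a segment runs from \<open>b\<^sub>i\<close> to
  \<open>a\<^sub>i\<^sub>+\<^sub>1\<close>, and the last one is a single vertex. The initial
  \<open>a\<^sub>1\<close> is put in front separately.\<close>

fun segments :: "('a \<Rightarrow> 'a \<Rightarrow> bool) \<Rightarrow> ('a \<Rightarrow> 'a) \<Rightarrow> 'a list \<Rightarrow> 'a list list \<Rightarrow> bool" where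
  "segments E \<rho> [b] [A] \<longleftrightarrow> A = [b]"
| "segments E \<rho> (b # b' # bs) (A # Ss) \<longleftrightarrow>
     A \<noteq> [] \<and> successively E A \<and> hd A = b \<and> last A = \<rho> b' \<and> segments E \<rho> (b' # bs) Ss"
| "segments E \<rho> _ _ \<longleftrightarrow> False"

lemma segments_weavable:
  assumes "segments E \<rho> bs Ss" "odd (length bs)" "successively (\<lambda>b b'. E (\<rho> b) b') bs"
    and "E x (hd bs)" "E (\<rho> (last bs)) y"
  shows "weavable E (\<rho> (hd bs)) x y Ss"
  using assms
proof (induction bs arbitrary: Ss x rule: induct_list012)
  case (2 b)
  then obtain A where "Ss = [A]" "A = [b]" by (cases "(E, \<rho>, [b], Ss)" rule: segments.cases) auto
  then show ?case using 2 by simp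
next
  case (3 b b' bs)
  then obtain b'' bs' where bs: "bs = b'' # bs'" by (cases bs) auto
  obtain A Ss' where Ss: "Ss = A # Ss'" using "3.prems"(1) by (cases Ss) auto
  obtain B Ss'' where Ss': "Ss' = B # Ss''" using "3.prems"(1) by (cases Ss') (auto simp: Ss bs)
  have "weavable E (\<rho> (hd bs)) (last A) y Ss''"
    by (rule "3.IH"(1)) (use "3.prems" in \<open>auto simp: bs Ss Ss'\<close>)
  then show ?case using "3.prems" by (auto simp: bs Ss Ss')
qed simp

lemma segments_concat:
  assumes "segments E \<rho> bs Ss" "\<And>b. b \<in> set bs \<Longrightarrow> E (\<rho> b) b"
  shows "(\<forall>A\<in>set Ss. A \<noteq> [] \<and> successively E A) \<and> successively E (concat Ss) \<and>
    Ss \<noteq> [] \<and> concat Ss \<noteq> [] \<and> hd (concat Ss) = hd bs \<and> last (concat Ss) = last (last Ss)"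
  using assms
proof (induction E \<rho> bs Ss rule: segments.induct)
  case (2 E \<rho> b b' bs A Ss)
  then have IH: "(\<forall>A\<in>set Ss. A \<noteq> [] \<and> successively E A) \<and> successively E (concat Ss) \<and>
    Ss \<noteq> [] \<and> concat Ss \<noteq> [] \<and> hd (concat Ss) = b' \<and> last (concat Ss) = last (last Ss)" by simp
  moreover have "E (\<rho> b') b'" using "2.prems"(2) by simp
  ultimately show ?case using "2.prems"(1) by (auto simp: successively_append_iff)
qed auto

lemma segments_absorb:
  assumes "segments E \<rho> bs Ss" "odd (length bs)" "successively (\<lambda>b b'. E (\<rho> b) b') bs"
    and "\<And>b. b \<in> set bs \<Longrightarrow> E (\<rho> b) b"
  shows "successively E (\<rho> (hd bs) # concat Ss)"
    and "absorbs E (\<rho> (hd bs) # concat Ss) {(x, y). E x (hd bs) \<and> E (\<rho> (last bs)) y}"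
proof -
  have bs: "bs \<noteq> []" using assms(2) by auto
  note Ss = segments_concat[OF assms(1,4)]
  show "successively E (\<rho> (hd bs) # concat Ss)"
    using Ss assms(4)[of "hd bs"] bs by (simp add: successively_Cons)
  show "absorbs E (\<rho> (hd bs) # concat Ss) {(x, y). E x (hd bs) \<and> E (\<rho> (last bs)) y}"
    unfolding absorbs_def
  proof (intro allI impI)
    fix Q assume Q: "Q \<noteq> []" "successively E Q" "(last Q, hd Q) \<in> {(x, y). E x (hd bs) \<and> E (\<rho> (last bs)) y}"
    have "weavable E (last [\<rho> (hd bs)]) (last Q) (hd Q) Ss"
      using segments_weavable[OF assms(1-3)] Q(3) by auto
    from weave[OF this _ _ Q(1,2)] Ss
    show "\<exists>P'. P' \<noteq> [] \<and> successively E P' \<and> hd P' = hd (\<rho> (hd bs) # concat Ss) \<and>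
      last P' = last (\<rho> (hd bs) # concat Ss) \<and> mset P' = mset (\<rho> (hd bs) # concat Ss) + mset Q"
      by auto
  qed
qed

section \<open>Connections of fixed length\<close>

locale robust_digraph =
  fixes V :: "'a set" and E :: "'a \<Rightarrow> 'a \<Rightarrow> bool" and m q t d k :: nat
  assumes fin: "finite V" and robust_expander: "robust_expander V E (m + q) t"
    and out: "\<And>v. v \<in> V \<Longrightarrow> d \<le> card {u \<in> V. E v u}" and inn: "\<And>v. v \<in> V \<Longrightarrow> d \<le> card {u \<in> V. E u v}"
    and d: "t + 2 * q + m \<le> d" and t: "2 * (t + q) \<le> card V" and k: "card V \<le> k * m" "even k"
begin

lemma connection:
  assumes "u \<in> V" "v \<in> V" "finite W" "card W + k + 1 < m"
  obtains M where "length M = Suc k" "set M \<subseteq> V - W" "distinct M" "successively E (u # M @ [v])"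
proof -
  have "robust_expander V E m (t + q)" by (rule robust_expander_mono[OF robust_expander fin]) auto
  then obtain M where M: "length M = Suc k" "set M \<subseteq> V" "hd M \<in> {w \<in> V. E u w}" "last M \<in> {w \<in> V. E w v}"
    "successively E M" "sorted_wrt (\<lambda>u v. u \<notin> {v}) M" "set M \<inter> W = {}"
    by (rule robust_expander_chain[OF fin _ t, of E m "{w \<in> V. E u w}" "{w \<in> V. E w v}" k "\<lambda>v. {v}" 1 W])
      (use out[OF assms(1)] inn[OF assms(2)] d k assms(3,4) in auto)
  have "M \<noteq> []" using M(1) by auto
  moreover have "distinct M" using M(6) by (simp add: distinct_conv_nth sorted_wrt_iff_nth_less) (metis nat_neq_iff)
  ultimately show ?thesis using M by (intro that[of M]) (auto simp: successively_append_iff successively_Cons)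
qed

text \<open>Segments are built from the last to the first, the ends of earlier ones being added to
  the forbidden set. Each costs at most \<open>k + 3\<close> vertices: two ends and a connection
  with \<open>k + 1\<close> inner vertices.\<close>

lemma segments_exist:
  assumes "bs \<noteq> []" "set bs \<subseteq> V" "\<rho> ` set bs \<subseteq> V" "distinct (bs @ map \<rho> (tl bs))"
    "set (bs @ map \<rho> (tl bs)) \<inter> W = {}" "finite W" "card W + length bs * (k + 3) < m"
  shows "\<exists>Ss. segments E \<rho> bs Ss \<and> distinct (concat Ss) \<and> set (concat Ss) \<subseteq> V - W \<and>
    length (concat Ss) \<le> length bs * (k + 3)"
  using assms
proof (induction bs arbitrary: W rule: induct_list012)
  case (2 b)
  then show ?case by (intro exI[of _ "[[b]]"]) auto
next
  case (3 b b' bs)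
  let ?W = "W \<union> {b, \<rho> b'}"
  have "card ?W \<le> card W + card {b, \<rho> b'}" by (rule card_Un_le)
  also have "card {b, \<rho> b'} \<le> 2" by (simp add: card_insert_if)
  finally have W: "card ?W \<le> card W + 2" by simp
  have "\<exists>Ss. segments E \<rho> (b' # bs) Ss \<and> distinct (concat Ss) \<and> set (concat Ss) \<subseteq> V - ?W \<and>
    length (concat Ss) \<le> length (b' # bs) * (k + 3)"
    by (rule "3.IH"(2)) (use "3.prems" W in auto)
  then obtain Ss where Ss: "segments E \<rho> (b' # bs) Ss" "distinct (concat Ss)" "set (concat Ss) \<subseteq> V - ?W"
    "length (concat Ss) \<le> length (b' # bs) * (k + 3)" by blast
  have "card (?W \<union> set (concat Ss)) \<le> card ?W + card (set (concat Ss))" by (rule card_Un_le)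
  also have "\<dots> \<le> card W + 2 + length (b' # bs) * (k + 3)"
    using W Ss(4) card_length[of "concat Ss"] by linarith
  finally have "card (?W \<union> set (concat Ss)) + k + 1 < m" using "3.prems"(7) by simp
  then obtain M where M: "length M = Suc k" "set M \<subseteq> V - (?W \<union> set (concat Ss))" "distinct M"
      "successively E (b # M @ [\<rho> b'])"
    using connection[of b "\<rho> b'" "?W \<union> set (concat Ss)"] "3.prems" by auto
  let ?Ss = "(b # M @ [\<rho> b']) # Ss"
  have "segments E \<rho> (b # b' # bs) ?Ss" using Ss(1) M(4) by simp
  moreover have "distinct (concat ?Ss)" using Ss(2,3) M(2,3) "3.prems"(4) by auto
  moreover have "set (concat ?Ss) \<subseteq> V - W" using Ss(3) M(2) "3.prems" by auto
  moreover have "length (concat ?Ss) \<le> length (b # b' # bs) * (k + 3)" using Ss(4) M(1) by simp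
  ultimately show ?case by blast
qed simp

end

lemma absorbs_append:
  assumes "absorbs E P U" "P \<noteq> []" "successively E (xs @ P @ ys)"
  shows "absorbs E (xs @ P @ ys) U"
  unfolding absorbs_def
proof (intro allI impI)
  fix Q assume "Q \<noteq> []" "successively E Q" "(last Q, hd Q) \<in> U"
  with assms(1) obtain P' where "P' \<noteq> []" "successively E P'" "hd P' = hd P" "last P' = last P"
    "mset P' = mset P + mset Q" unfolding absorbs_def by blast
  then show "\<exists>P'. P' \<noteq> [] \<and> successively E P' \<and> hd P' = hd (xs @ P @ ys) \<and>
      last P' = last (xs @ P @ ys) \<and> mset P' = mset (xs @ P @ ys) + mset Q"
    using assms(2,3) by (intro exI[of _ "xs @ P' @ ys"]) (auto simp: successively_append_iff hd_append last_append)
qed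

lemma absorbs_Un: "absorbs E P U \<Longrightarrow> absorbs E P U' \<Longrightarrow> absorbs E P (U \<union> U')"
  by (auto simp: absorbs_def)

lemma absorbs_mono: "absorbs E P U \<Longrightarrow> U' \<subseteq> U \<Longrightarrow> absorbs E P U'"
  by (auto simp: absorbs_def)

text \<open>\<open>NS\<close> holds vertices \<open>b\<close> that \<open>\<rho> b\<close>
  dominates. \<open>z\<close> bounds the vertices spent so far; it counts twice because a spent
  vertex excludes itself and its preimage under \<open>\<rho>\<close>. \<open>e\<close> is a number
  of choices that always remain, at least a fraction \<open>1 / A\<close> of all vertices.\<close>

locale absorption = robust_digraph +
  fixes \<rho> :: "'a \<Rightarrow> 'a" and NS :: "'a set" and z e A :: nat
  assumes \<rho>: "bij_betw \<rho> V V" and NS: "NS \<subseteq> V" "card (V - NS) \<le> q"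
    "\<And>b. b \<in> NS \<Longrightarrow> E (\<rho> b) b" "\<And>b. b \<in> NS \<Longrightarrow> \<rho> b \<noteq> b"
    and z: "2 * z + (k + 3) * (k + 3) + 1 < m"
    and e: "e + 2 * z + q + 3 \<le> d" "card V \<le> A * e"
begin

lemma \<rho>_inj: "inj_on \<rho> V" and \<rho>_img: "\<rho> ` V = V"
  using \<rho> by (auto simp: bij_betw_def)

lemma \<rho>_in: "v \<in> V \<Longrightarrow> \<rho> v \<in> V"
  using \<rho>_img by blast

lemma card_\<rho>_preimage: "finite W \<Longrightarrow> card {u \<in> V. \<rho> u \<in> W} \<le> card W"
  by (rule card_inj_on_le[of \<rho>]) (auto intro: inj_on_subset[OF \<rho>_inj])

lemma card_in_shifted:
  assumes "v \<in> V" shows "d \<le> card {u \<in> V. E (\<rho> u) v}"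
proof -
  have "{u \<in> V. E u v} = \<rho> ` {u \<in> V. E (\<rho> u) v}"
    by (subst (1) \<rho>_img[symmetric]) auto
  then have "card {u \<in> V. E u v} = card {u \<in> V. E (\<rho> u) v}"
    using card_image[OF inj_on_subset[OF \<rho>_inj, of "{u \<in> V. E (\<rho> u) v}"]] by auto
  then show ?thesis using inn[OF assms] by simp
qed

text \<open>For \<open>u\<close> and \<open>v\<close> in \<open>V\<close>, \<open>u\<close> lies in
  this set exactly if \<open>{u, \<rho> u}\<close> and \<open>{v, \<rho> v}\<close> meet, as
  \<open>\<rho>\<close> is injective.\<close>

definition conflict :: "'a \<Rightarrow> 'a set" where
  "conflict v = {v, \<rho> v} \<union> {u \<in> V. \<rho> u = v}"

lemma conflict: "finite (conflict v)" "card (conflict v) \<le> 3"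
proof -
  have fin': "finite {u \<in> V. \<rho> u = v}" using fin by simp
  then show "finite (conflict v)" by (simp add: conflict_def)
  have "card (conflict v) \<le> card {v, \<rho> v} + card {u \<in> V. \<rho> u = v}"
    unfolding conflict_def by (rule card_Un_le)
  moreover have "card {u \<in> V. \<rho> u = v} \<le> 1" using card_\<rho>_preimage[of "{v}"] by simp
  moreover have "card {v, \<rho> v} \<le> 2" by (simp add: card_insert_if)
  ultimately show "card (conflict v) \<le> 3" by linarith
qed

lemma conflict_sym: "u \<in> V \<Longrightarrow> v \<in> V \<Longrightarrow> u \<in> conflict v \<longleftrightarrow> v \<in> conflict u"
  by (auto simp: conflict_def)

definition blocked :: "'a set \<Rightarrow> 'a set" where
  "blocked W = W \<union> {u \<in> V. \<rho> u \<in> W}"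

lemma blocked: "finite W \<Longrightarrow> finite (blocked W)" "finite W \<Longrightarrow> card (blocked W) \<le> 2 * card W"
  using fin card_Un_le[of W "{u \<in> V. \<rho> u \<in> W}"] card_\<rho>_preimage[of W] by (auto simp: blocked_def)

text \<open>A chain of the shifted relation from \<open>b\<close> to \<open>b'\<close> supplies the
  edges from each \<open>\<rho> b\<^sub>i\<close> to the next vertex of the chain. Avoiding
  conflicts keeps all vertices and their images distinct, and connections between consecutive pairs
  make a path of them.\<close>

lemma block_exists:
  assumes b: "b \<in> NS" "b' \<in> NS" "b \<notin> blocked W" "b' \<notin> blocked W" "b \<notin> conflict b'"
    and W: "finite W" "card W \<le> z"
  obtains B where "B \<noteq> []" "distinct B" "set B \<subseteq> V - W" "successively E B"
    "length B \<le> (k + 3) * (k + 3) + 1" "absorbs E B {(x, y). E x b \<and> E (\<rho> b') y}"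
proof -
  let ?D = "\<lambda>b b'. E (\<rho> b) b' \<and> b' \<in> NS"
  have bV: "b \<in> V" "b' \<in> V" using b NS(1) by auto
  have rD: "robust_expander V ?D m (t + q)"
    using robust_expander_shift[OF robust_expander fin \<rho>_inj _ NS(2)] \<rho>_img by simp
  let ?W = "blocked W \<union> (conflict b \<union> conflict b')"
  have "card ?W \<le> card (blocked W) + card (conflict b \<union> conflict b')" by (rule card_Un_le)
  also have "\<dots> \<le> card (blocked W) + (card (conflict b) + card (conflict b'))"
    by (intro add_left_mono card_Un_le)
  finally have "card ?W \<le> 2 * z + 6"
    using blocked(2)[OF W(1)] W(2) conflict(2)[of b] conflict(2)[of b'] by linarith
  then have cW: "card ?W + (k + 1) * 3 < m" using z by (simp add: algebra_simps)
  have fW: "finite ?W" using W(1) by (simp add: blocked conflict)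
  let ?S = "{v \<in> V. E (\<rho> b) v} \<inter> NS" and ?T = "{v \<in> V. E (\<rho> v) b'}"
  have "d \<le> card {v \<in> V. E (\<rho> b) v}" using out[OF \<rho>_in[OF bV(1)]] .
  also have "\<dots> \<le> card (?S \<union> (V - NS))" by (intro card_mono) (auto simp: fin)
  also have "\<dots> \<le> card ?S + card (V - NS)" by (rule card_Un_le)
  finally have S: "t + q \<le> card ?S" using NS(2) d by linarith
  have T: "t + q + m \<le> card ?T" using card_in_shifted[OF bV(2)] d by linarith
  obtain xs where xs: "length xs = Suc k" "set xs \<subseteq> V" "hd xs \<in> ?S" "last xs \<in> ?T"
    "successively ?D xs" "sorted_wrt (\<lambda>u v. u \<notin> conflict v) xs" "set xs \<inter> ?W = {}"
    by (rule robust_expander_chain[OF fin rD t, of ?S ?T k conflict 3 ?W]) (use S T k cW fW conflict in auto)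
  have xs_ne: "xs \<noteq> []" using xs(1) by auto
  define bs where "bs = b # xs @ [b']"
  have xsNS: "set xs \<subseteq> NS"
  proof -
    have "set ys \<subseteq> NS" if "successively ?D ys" "ys \<noteq> []" "hd ys \<in> NS" for ys
      using that by (induction ys) (auto simp: successively_Cons, metis empty_iff list.set(1) subsetD)
    then show ?thesis using xs(3,5) xs_ne by auto
  qed
  have bsNS: "set bs \<subseteq> NS" using xsNS b by (auto simp: bs_def)
  have bsV: "set bs \<subseteq> V" using bsNS NS(1) by auto
  have bs_chain: "successively (\<lambda>b b'. E (\<rho> b) b') bs"
    using xs(3,4) xs_ne successively_mono[OF xs(5), of "\<lambda>b b'. E (\<rho> b) b'"]
    by (auto simp: bs_def successively_append_iff successively_Cons)
  have "sorted_wrt (\<lambda>u v. u \<notin> conflict v) bs"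
    using xs(6,7) b(5) conflict_sym[OF bV(1)] xs(2) by (auto simp: bs_def sorted_wrt_append)
  then have nth_conflict: "bs ! i \<notin> conflict (bs ! j) \<and> bs ! j \<notin> conflict (bs ! i)"
    if "i < j" "j < length bs" for i j
  proof -
    have "bs ! i \<in> V" "bs ! j \<in> V" using that bsV by (auto intro: subsetD[OF _ nth_mem])
    then show ?thesis
      using \<open>sorted_wrt _ bs\<close> that conflict_sym[of "bs ! j" "bs ! i"] by (auto simp: sorted_wrt_iff_nth_less)
  qed
  have no_conflict: "bs ! i \<notin> conflict (bs ! j)" if "i \<noteq> j" "i < length bs" "j < length bs" for i j
    using nth_conflict[of i j] nth_conflict[of j i] that by (cases "i < j") auto
  have dist: "distinct bs"
    unfolding distinct_conv_nth using no_conflict by (auto simp: conflict_def)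
  have disj: "set bs \<inter> \<rho> ` set bs = {}"
  proof -
    have "\<rho> (bs ! j) \<noteq> bs ! i" if "i < length bs" "j < length bs" for i j
    proof (cases "i = j")
      case True
      then show ?thesis using NS(4)[of "bs ! j"] subsetD[OF bsNS nth_mem[of j bs]] that by auto
    next
      case False
      then show ?thesis using no_conflict[OF False that] by (auto simp: conflict_def)
    qed
    then show ?thesis by (fastforce simp: set_conv_nth)
  qed
  have dist\<rho>: "distinct (map \<rho> bs)"
    using dist inj_on_subset[OF \<rho>_inj bsV] by (simp add: distinct_map)
  have "set bs \<inter> blocked W = {}" using xs(7) b(3,4) by (auto simp: bs_def)
  then have avoid: "set bs \<inter> W = {}" "\<rho> ` set bs \<inter> W = {}" using bsV by (auto simp: blocked_def)
  have lbs: "length bs = k + 3" using xs(1) by (simp add: bs_def)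
  have dist_all: "distinct (bs @ map \<rho> (tl bs))" "\<rho> b \<notin> set (bs @ map \<rho> (tl bs))"
    using dist dist\<rho> disj by (auto simp: bs_def)
  have "card (insert (\<rho> b) W) \<le> z + 1" using W by (simp add: card_insert_if)
  then have "card (insert (\<rho> b) W) + length bs * (k + 3) < m" using z lbs by simp
  moreover have "set (bs @ map \<rho> (tl bs)) \<inter> insert (\<rho> b) W = {}"
    using avoid dist_all(2) by (auto simp: bs_def)
  moreover have "bs \<noteq> []" "\<rho> ` set bs \<subseteq> V" using bsV \<rho>_in by (auto simp: bs_def)
  ultimately obtain Ss where Ss: "segments E \<rho> bs Ss" "distinct (concat Ss)"
      "set (concat Ss) \<subseteq> V - insert (\<rho> b) W" "length (concat Ss) \<le> length bs * (k + 3)"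
    using segments_exist[OF _ bsV _ dist_all(1)] W(1) by (meson finite_insert)
  \<comment> \<open>The \<open>k + 1\<close> chain vertices together with \<open>b\<close> and
    \<open>b'\<close> number \<open>k + 3\<close>; this is where \<open>even k\<close>
    enters.\<close>
  have odd: "odd (length bs)" using lbs k(2) by simp
  note abs = segments_absorb[OF Ss(1) odd bs_chain]
  have hl: "hd bs = b" "last bs = b'" by (simp_all add: bs_def)
  show ?thesis
  proof (rule that[of "\<rho> b # concat Ss"])
    show "distinct (\<rho> b # concat Ss)" using Ss(2,3) by auto
    show "set (\<rho> b # concat Ss) \<subseteq> V - W" using Ss(3) avoid \<rho>_in bV by (auto simp: bs_def)
    show "successively E (\<rho> b # concat Ss)" "absorbs E (\<rho> b # concat Ss) {(x, y). E x b \<and> E (\<rho> b') y}"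
      using abs NS(3) bsNS unfolding hl by auto
    show "length (\<rho> b # concat Ss) \<le> (k + 3) * (k + 3) + 1" using Ss(4) lbs by simp
  qed simp
qed

text \<open>Averaging over the pairs \<open>(b, b')\<close>: each \<open>(x, y)\<close> is absorbed by at least \<open>e\<^sup>2\<close> of them.\<close>

lemma good_pair_exists:
  assumes W: "finite W" "card W \<le> z" and U: "U \<subseteq> V \<times> V" "U \<noteq> {}"
  obtains b b' where "b \<in> NS" "b' \<in> NS" "b \<notin> blocked W" "b' \<notin> blocked W" "b \<notin> conflict b'"
    "card U \<le> A\<^sup>2 * card (U \<inter> {(x, y). E x b \<and> E (\<rho> b') y})"
proof -
  define Ps where "Ps = {(b, b') \<in> NS \<times> NS. b \<notin> blocked W \<and> b' \<notin> blocked W \<and> b \<notin> conflict b'}"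
  define R where "R = (\<lambda>(b, b') (x, y). E x b \<and> E (\<rho> b') y)"
  have Ps: "Ps \<subseteq> V \<times> V" using NS(1) by (auto simp: Ps_def)
  have finP: "finite Ps" by (rule finite_subset[OF Ps]) (simp add: fin)
  have finU: "finite U" by (rule finite_subset[OF U(1)]) (simp add: fin)
  have bound: "e \<le> card (X \<inter> NS - blocked W - conflict v)" if "X \<subseteq> V" "d \<le> card X" for X v
  proof -
    have "X \<subseteq> (X \<inter> NS - blocked W - conflict v) \<union> ((V - NS) \<union> (blocked W \<union> conflict v))" (is "_ \<subseteq> ?Y \<union> _")
      using that(1) by auto
    then have "card X \<le> card (?Y \<union> ((V - NS) \<union> (blocked W \<union> conflict v)))"
      by (intro card_mono) (use fin finite_subset[OF that(1)] blocked(1)[OF W(1)] conflict in auto)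
    also have "\<dots> \<le> card ?Y + (card (V - NS) + (card (blocked W) + card (conflict v)))"
      by (intro order_trans[OF card_Un_le] add_left_mono) simp
    finally show ?thesis
      using that(2) e(1) NS(2) blocked(2)[OF W(1)] W(2) conflict(2)[of v] by linarith
  qed
  have many: "e * e \<le> card {p \<in> Ps. R p u}" if "u \<in> U" for u
  proof -
    obtain x y where u: "u = (x, y)" "x \<in> V" "y \<in> V" using \<open>u \<in> U\<close> U(1) by auto
    define X where "X = {b \<in> V. E x b} \<inter> NS - blocked W - conflict x"
    define Y where "Y b = {b' \<in> V. E (\<rho> b') y} \<inter> NS - blocked W - conflict b" for b
    have X: "e \<le> card X" unfolding X_def by (rule bound) (use out u in auto)
    have Y: "e \<le> card (Y b)" for b unfolding Y_def by (rule bound) (use card_in_shifted u in auto)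
    have "Sigma X Y \<subseteq> {p \<in> Ps. R p u}"
      using NS(1) conflict_sym by (auto simp: X_def Y_def Ps_def R_def u)
    then have "card (Sigma X Y) \<le> card {p \<in> Ps. R p u}" by (intro card_mono) (use finP in auto)
    moreover have "card (Sigma X Y) = (\<Sum>b\<in>X. card (Y b))"
      by (rule card_SigmaI) (auto simp: X_def Y_def fin)
    moreover have "card X * e \<le> (\<Sum>b\<in>X. card (Y b))"
      using sum_mono[of X "\<lambda>_. e" "\<lambda>b. card (Y b)"] Y by simp
    moreover have "e * e \<le> card X * e" using X by (rule mult_le_mono1)
    ultimately show ?thesis by linarith
  qed
  \<comment> \<open>Otherwise \<open>A\<^sup>2\<close> times the number absorbed by any pair is at
    most \<open>card U - 1\<close>. Summed over at most \<open>(A * e)\<^sup>2\<close> pairs, this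
    contradicts the lower bound \<open>card U * (e * e)\<close> on the total.\<close>
  have "\<exists>p\<in>Ps. card U \<le> A\<^sup>2 * card {u \<in> U. R p u}"
  proof (rule ccontr)
    assume "\<not> ?thesis"
    then have less: "A\<^sup>2 * card {u \<in> U. R p u} \<le> card U - 1" if "p \<in> Ps" for p using that by force
    have "card U * (e * e) \<le> (\<Sum>u\<in>U. card {p \<in> Ps. R p u})"
      using sum_mono[of U "\<lambda>_. e * e"] many by simp
    also have "\<dots> = (\<Sum>p\<in>Ps. card {u \<in> U. R p u})"
      by (rule sum_multicount_gen[OF finU finP]) simp
    finally have "A\<^sup>2 * (card U * (e * e)) \<le> A\<^sup>2 * (\<Sum>p\<in>Ps. card {u \<in> U. R p u})" by (rule mult_le_mono2)
    also have "\<dots> \<le> (\<Sum>p\<in>Ps. card U - 1)"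
      unfolding sum_distrib_left by (intro sum_mono less)
    also have "\<dots> = card Ps * (card U - 1)" by simp
    also have "card Ps \<le> card V * card V"
      using card_mono[OF _ Ps] fin by (simp add: card_cartesian_product)
    also have "card V * card V \<le> (A * e) * (A * e)" by (intro mult_le_mono e(2))
    finally have "card U * ((A * e) * (A * e)) \<le> (card U - 1) * ((A * e) * (A * e))"
      by (simp add: power2_eq_square ac_simps)
    moreover have "card V > 0" using U fin by (auto simp: card_gt_0_iff)
    then have "A * e > 0" using e(2) by linarith
    ultimately have "card U \<le> card U - 1" by simp
    then show False using U(2) finU by (cases "card U") auto
  qed
  then obtain b b' where "(b, b') \<in> Ps" "card U \<le> A\<^sup>2 * card {u \<in> U. R (b, b') u}" by auto
  moreover have "{u \<in> U. R (b, b') u} = U \<inter> {(x, y). E x b \<and> E (\<rho> b') y}" by (auto simp: R_def)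
  ultimately show ?thesis using that unfolding Ps_def by auto
qed

end

section \<open>From absorbing blocks to a Hamilton cycle\<close>

context absorption
begin

abbreviation block_cost :: nat where "block_cost \<equiv> (k + 3) * (k + 3) + k + 2"

text \<open>Appending a connection and a block for a good pair keeps what is already absorbed and
  handles at least a fraction \<open>1 / A\<^sup>2\<close> of the remaining pairs.
  \<open>block_cost\<close> is the block plus \<open>k + 1\<close> connecting vertices.\<close>

lemma absorbing_path_step:
  assumes R: "R \<noteq> []" "distinct R" "set R \<subseteq> V - Z" "successively E R" "absorbs E R (V \<times> V - U)"
    and Z: "finite Z" "card Z + length R + block_cost \<le> z" and U: "U \<subseteq> V \<times> V" "U \<noteq> {}"
  obtains R' U' where "R' \<noteq> []" "distinct R'" "set R' \<subseteq> V - Z" "successively E R'"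
    "length R' \<le> length R + block_cost" "absorbs E R' (V \<times> V - U')" "U' \<subseteq> V \<times> V"
    "A\<^sup>2 * card U' \<le> (A\<^sup>2 - 1) * card U"
proof -
  let ?W = "Z \<union> set R"
  have "card ?W \<le> card Z + length R" using card_Un_le[of Z "set R"] card_length[of R] by linarith
  then have W: "finite ?W" "card ?W \<le> z" using Z by simp_all
  obtain b b' where b: "b \<in> NS" "b' \<in> NS" "b \<notin> blocked ?W" "b' \<notin> blocked ?W" "b \<notin> conflict b'"
    "card U \<le> A\<^sup>2 * card (U \<inter> {(x, y). E x b \<and> E (\<rho> b') y})"
    by (rule good_pair_exists[OF W U])
  obtain B where B: "B \<noteq> []" "distinct B" "set B \<subseteq> V - ?W" "successively E B"
    "length B \<le> (k + 3) * (k + 3) + 1" "absorbs E B {(x, y). E x b \<and> E (\<rho> b') y}"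
    by (rule block_exists[OF b(1-5) W])
  let ?W' = "?W \<union> set B"
  have "card ?W' \<le> card ?W + length B" using card_Un_le[of ?W "set B"] card_length[of B] by linarith
  then have "card ?W' + k + 1 < m" using \<open>card ?W \<le> card Z + length R\<close> B(5) Z(2) z by simp
  moreover have "last R \<in> V" "hd B \<in> V" using R(1,3) B(1,3) by (auto dest: last_in_set hd_in_set)
  ultimately obtain M where M: "length M = Suc k" "set M \<subseteq> V - ?W'" "distinct M"
      "successively E (last R # M @ [hd B])"
    using connection[of "last R" "hd B" ?W'] Z(1) by auto
  have M_ne: "M \<noteq> []" using M(1) by auto
  let ?R = "R @ M @ B"
  have succ: "successively E ?R"
    using R(1,4) B(1,4) M(4) M_ne by (auto simp: successively_append_iff successively_Cons)
  let ?G = "{(x, y). E x b \<and> E (\<rho> b') y}"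
  have "absorbs E ([] @ R @ (M @ B)) (V \<times> V - U)" by (rule absorbs_append) (use R succ in auto)
  moreover have "absorbs E ((R @ M) @ B @ []) ?G" by (rule absorbs_append) (use B succ in auto)
  ultimately have "absorbs E ?R ((V \<times> V - U) \<union> ?G)" by (intro absorbs_Un) simp_all
  then have abs: "absorbs E ?R (V \<times> V - (U - ?G))" by (rule absorbs_mono) blast
  have finU: "finite U" by (rule finite_subset[OF U(1)]) (simp add: fin)
  have "card U = card (U \<inter> ?G) + card (U - ?G)" using card_Int_Diff[OF finU] by simp
  then have "A\<^sup>2 * card U = A\<^sup>2 * card (U \<inter> ?G) + A\<^sup>2 * card (U - ?G)" by (simp add: distrib_left)
  then have "A\<^sup>2 * card (U - ?G) \<le> (A\<^sup>2 - 1) * card U" using b(6) by (simp add: diff_mult_distrib)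
  moreover have "length ?R \<le> length R + block_cost" using M(1) B(5) by simp
  moreover have "distinct ?R" "set ?R \<subseteq> V - Z" using R M B by auto
  moreover have "U - ?G \<subseteq> V \<times> V" "?R \<noteq> []" using U(1) R(1) by auto
  ultimately show ?thesis using succ abs by (intro that[of ?R "U - ?G"])
qed

lemma absorbing_path_rounds:
  assumes Z: "finite Z" "card Z + 1 + j * block_cost \<le> z" "card Z < card V"
  shows "\<exists>R U. R \<noteq> [] \<and> distinct R \<and> set R \<subseteq> V - Z \<and> successively E R \<and> length R \<le> 1 + j * block_cost \<and>
    absorbs E R (V \<times> V - U) \<and> U \<subseteq> V \<times> V \<and> (A\<^sup>2) ^ j * card U \<le> (A\<^sup>2 - 1) ^ j * (card V)\<^sup>2"
  using Z(2)
proof (induction j)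
  case 0
  have "\<not> V \<subseteq> Z" using Z(1,3) card_mono[of Z V] by auto
  then obtain v where "v \<in> V - Z" by blast
  then show ?case
    by (intro exI[of _ "[v]"] exI[of _ "V \<times> V"]) (auto simp: absorbs_def card_cartesian_product power2_eq_square)
next
  case (Suc j)
  then obtain R U where R: "R \<noteq> []" "distinct R" "set R \<subseteq> V - Z" "successively E R" "length R \<le> 1 + j * block_cost"
    "absorbs E R (V \<times> V - U)" "U \<subseteq> V \<times> V" "(A\<^sup>2) ^ j * card U \<le> (A\<^sup>2 - 1) ^ j * (card V)\<^sup>2" by auto
  show ?case
  proof (cases "U = {}")
    case True
    then show ?thesis using R by (intro exI[of _ R] exI[of _ "{}"]) auto
  next
    case False
    have "card Z + length R + block_cost \<le> z" using Suc.prems R(5) by simp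
    then obtain R' U' where R': "R' \<noteq> []" "distinct R'" "set R' \<subseteq> V - Z" "successively E R'"
      "length R' \<le> length R + block_cost" "absorbs E R' (V \<times> V - U')" "U' \<subseteq> V \<times> V"
      "A\<^sup>2 * card U' \<le> (A\<^sup>2 - 1) * card U"
      by (rule absorbing_path_step[OF R(1-4,6) Z(1) _ R(7) False])
    have "(A\<^sup>2) ^ Suc j * card U' = (A\<^sup>2) ^ j * (A\<^sup>2 * card U')" by (simp add: ac_simps)
    also have "\<dots> \<le> (A\<^sup>2) ^ j * ((A\<^sup>2 - 1) * card U)" using R'(8) by (rule mult_le_mono2)
    also have "\<dots> = (A\<^sup>2 - 1) * ((A\<^sup>2) ^ j * card U)" by (simp add: ac_simps)
    also have "\<dots> \<le> (A\<^sup>2 - 1) * ((A\<^sup>2 - 1) ^ j * (card V)\<^sup>2)" using R(8) by (rule mult_le_mono2)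
    finally have card_U': "(A\<^sup>2) ^ Suc j * card U' \<le> (A\<^sup>2 - 1) ^ Suc j * (card V)\<^sup>2"
      by (simp only: power_Suc mult.assoc)
    have "length R' \<le> 1 + Suc j * block_cost" using R'(5) R(5) by simp
    with R'(1-4,6,7) card_U' show ?thesis by blast
  qed
qed

context
  fixes T :: nat
  assumes T: "(A\<^sup>2 - 1) ^ T * (card V)\<^sup>2 < (A\<^sup>2) ^ T"
begin

abbreviation path_cost :: nat where "path_cost \<equiv> k + 2 + T * block_cost"

lemma absorbing_path_exists:
  assumes "finite Z" "card Z + path_cost \<le> z" "card Z < card V"
  obtains R where "R \<noteq> []" "distinct R" "set R \<subseteq> V - Z" "successively E R" "length R \<le> 1 + T * block_cost"
    "absorbs E R (V \<times> V)"
proof -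
  obtain R U where R: "R \<noteq> []" "distinct R" "set R \<subseteq> V - Z" "successively E R" "length R \<le> 1 + T * block_cost"
    "absorbs E R (V \<times> V - U)" "U \<subseteq> V \<times> V" "(A\<^sup>2) ^ T * card U \<le> (A\<^sup>2 - 1) ^ T * (card V)\<^sup>2"
    using absorbing_path_rounds[of Z T] assms by auto
  have "(A\<^sup>2) ^ T * card U < (A\<^sup>2) ^ T" using R(8) T by linarith
  then have "card U = 0" by (cases "card U") auto
  then have "U = {}" using finite_subset[OF R(7)] fin by simp
  then show ?thesis using that R by simp
qed

lemma absorbing_path_list:
  assumes "i * path_cost + 1 \<le> z" "z < card V"
  shows "\<exists>P. P \<noteq> [] \<and> distinct P \<and> set P \<subseteq> V \<and> successively E P \<and> length P \<le> i * path_cost + 1 \<and>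
    (\<forall>Qs. length Qs \<le> i \<longrightarrow> (\<forall>Q\<in>set Qs. Q \<noteq> [] \<and> successively E Q \<and> set Q \<subseteq> V) \<longrightarrow>
      (\<exists>P'. P' \<noteq> [] \<and> successively E P' \<and> hd P' = hd P \<and> last P' = last P \<and> mset P' = mset P + mset (concat Qs)))"
  using assms(1)
proof (induction i)
  case 0
  from assms(2) have "V \<noteq> {}" by auto
  then obtain v where "v \<in> V" by blast
  then show ?case by (intro exI[of _ "[v]"]) auto
next
  case (Suc i)
  then obtain P where P: "P \<noteq> []" "distinct P" "set P \<subseteq> V" "successively E P" "length P \<le> i * path_cost + 1"
    and P_abs: "\<And>Qs. length Qs \<le> i \<Longrightarrow> (\<forall>Q\<in>set Qs. Q \<noteq> [] \<and> successively E Q \<and> set Q \<subseteq> V) \<Longrightarrow>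
      (\<exists>P'. P' \<noteq> [] \<and> successively E P' \<and> hd P' = hd P \<and> last P' = last P \<and> mset P' = mset P + mset (concat Qs))"
    by auto
  have cP: "card (set P) = length P" by (rule distinct_card[OF P(2)])
  obtain R where R: "R \<noteq> []" "distinct R" "set R \<subseteq> V - set P" "successively E R" "length R \<le> 1 + T * block_cost"
    "absorbs E R (V \<times> V)"
    by (rule absorbing_path_exists[of "set P"]) (use cP P(5) Suc.prems assms(2) in auto)
  let ?W = "set P \<union> set R"
  have "card ?W \<le> length P + length R"
    using card_Un_le[of "set P" "set R"] cP card_length[of R] by linarith
  then have "card ?W + k + 1 < m" using P(5) R(5) Suc.prems z by simp
  moreover have "last P \<in> V" "hd R \<in> V" using P(1,3) R(1,3) by (auto dest: last_in_set hd_in_set)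
  ultimately obtain M where M: "length M = Suc k" "set M \<subseteq> V - ?W" "distinct M"
      "successively E (last P # M @ [hd R])"
    using connection[of "last P" "hd R" ?W] by auto
  have M_ne: "M \<noteq> []" using M(1) by auto
  show ?case
  proof (rule exI[of _ "P @ M @ R"], intro conjI allI impI)
    show "successively E (P @ M @ R)"
      using P(1,4) R(1,4) M(4) M_ne by (auto simp: successively_append_iff successively_Cons)
    show "length (P @ M @ R) \<le> Suc i * path_cost + 1" using P(5) R(5) M(1) by simp
    fix Qs assume Qs: "length Qs \<le> Suc i" "\<forall>Q\<in>set Qs. Q \<noteq> [] \<and> successively E Q \<and> set Q \<subseteq> V"
    obtain Qs' R' where R': "length Qs' \<le> i" "\<forall>Q\<in>set Qs'. Q \<noteq> [] \<and> successively E Q \<and> set Q \<subseteq> V"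
      "R' \<noteq> []" "successively E R'" "hd R' = hd R" "last R' = last R"
      "mset R' + mset (concat Qs') = mset R + mset (concat Qs)"
    proof (cases Qs)
      case Nil
      then show ?thesis using R that[of "[]" R] by simp
    next
      case (Cons Q Qs')
      then have "Q \<noteq> []" "successively E Q" "(last Q, hd Q) \<in> V \<times> V" using Qs(2) by (auto dest: last_in_set hd_in_set)
      then obtain R' where "R' \<noteq> []" "successively E R'" "hd R' = hd R" "last R' = last R" "mset R' = mset R + mset Q"
        using R(6) unfolding absorbs_def by blast
      then show ?thesis using that[of Qs' R'] Cons Qs by simp
    qed
    from P_abs[OF R'(1,2)] obtain P' where P': "P' \<noteq> []" "successively E P'" "hd P' = hd P" "last P' = last P"
      "mset P' = mset P + mset (concat Qs')" by blast
    have "successively E (P' @ M @ R')"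
      using P' R' M(4) M_ne by (auto simp: successively_append_iff successively_Cons)
    moreover have "mset (P' @ M @ R') = mset (P @ M @ R) + mset (concat Qs)"
      using P'(5) R'(7) by (simp add: ac_simps)
    ultimately show "\<exists>P'. P' \<noteq> [] \<and> successively E P' \<and> hd P' = hd (P @ M @ R) \<and> last P' = last (P @ M @ R) \<and>
      mset P' = mset (P @ M @ R) + mset (concat Qs)"
      using P' R' P(1) R(1) by (intro exI[of _ "P' @ M @ R'"]) auto
  qed (use P R M in auto)
qed

lemma hamilton_list_exists:
  assumes K: "K * path_cost + k + 2 \<le> z" "z < card V"
    and cover: "\<And>W. W \<subseteq> V \<Longrightarrow> card W \<le> z \<Longrightarrow> \<exists>F. path_cover E (mset_set (V - W)) F \<and> size F \<le> K"
  obtains zs where "zs \<noteq> []" "distinct zs" "set zs = V" "successively E zs" "E (last zs) (hd zs)"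
proof -
  obtain P where P: "P \<noteq> []" "distinct P" "set P \<subseteq> V" "successively E P" "length P \<le> K * path_cost + 1"
    and P_abs: "\<And>Qs. length Qs \<le> K \<Longrightarrow> (\<forall>Q\<in>set Qs. Q \<noteq> [] \<and> successively E Q \<and> set Q \<subseteq> V) \<Longrightarrow>
      (\<exists>P'. P' \<noteq> [] \<and> successively E P' \<and> hd P' = hd P \<and> last P' = last P \<and> mset P' = mset P + mset (concat Qs))"
    using absorbing_path_list[of K] K by auto
  have cP: "card (set P) = length P" by (rule distinct_card[OF P(2)])
  have "card (set P) + k + 1 < m" using cP P(5) K z by linarith
  moreover have "last P \<in> V" "hd P \<in> V" using P by auto
  ultimately obtain M where M: "length M = Suc k" "set M \<subseteq> V - set P" "distinct M"
      "successively E (last P # M @ [hd P])"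
    using connection[of "last P" "hd P" "set P"] by auto
  have M_ne: "M \<noteq> []" using M(1) by auto
  have dist: "distinct (P @ M)" using P M by auto
  have "card (set (P @ M)) \<le> z" using distinct_card[OF dist] P(5) M(1) K by simp
  then obtain F where F: "path_cover E (mset_set (V - set (P @ M))) F" "size F \<le> K"
    using cover[of "set (P @ M)"] P(3) M(2) by auto
  obtain Qs where Qs: "F = mset Qs" "distinct (concat Qs)" "set (concat Qs) = V - set (P @ M)"
    "\<And>Q. Q \<in> set Qs \<Longrightarrow> Q \<noteq> [] \<and> successively E Q"
    using path_cover_list[OF F(1)] fin by auto
  have "\<forall>Q\<in>set Qs. Q \<noteq> [] \<and> successively E Q \<and> set Q \<subseteq> V" using Qs(3,4) by auto
  then obtain P' where P': "P' \<noteq> []" "successively E P'" "hd P' = hd P" "last P' = last P"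
      "mset P' = mset P + mset (concat Qs)"
    using P_abs[of Qs] F(2) Qs(1) by auto
  have ms: "mset (P' @ M) = mset (P @ M @ concat Qs)" using P'(5) by (simp add: ac_simps)
  show ?thesis
  proof (rule that[of "P' @ M"])
    have "distinct (P @ M @ concat Qs)" using dist Qs(2,3) by auto
    then show "distinct (P' @ M)" using ms mset_eq_imp_distinct_iff by blast
    have "set (P' @ M) = set (P @ M @ concat Qs)" using ms by (metis set_mset_mset)
    then show "set (P' @ M) = V" using Qs(3) P(3) M(2) by auto
    show "successively E (P' @ M)"
      using P' M(4) M_ne by (auto simp: successively_append_iff successively_Cons)
    show "E (last (P' @ M)) (hd (P' @ M))"
      using P' M(4) M_ne by (auto simp: successively_append_iff successively_Cons)
  qed (simp add: P')
qed

end

end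

section \<open>Degree sequences\<close>

lemma card_Int_ge:
  assumes "finite V" "X \<subseteq> V" "S \<subseteq> V"
  shows "card X + card S \<le> card V + card (X \<inter> S)"
proof -
  have "card X + card S = card (X \<union> S) + card (X \<inter> S)"
    by (rule card_Un_Int) (use assms finite_subset in auto)
  moreover have "card (X \<union> S) \<le> card V" by (intro card_mono) (use assms in auto)
  ultimately show ?thesis by linarith
qed

lemma robust_nbhd_of_large_outdegree:
  assumes fin: "finite V" and X: "X \<subseteq> S" "S \<subseteq> V" "g \<le> card X" "0 < g"
    and D: "\<And>x. x \<in> X \<Longrightarrow> D \<le> card {u \<in> V. E x u}" and m: "card V * m \<le> g * g"
  shows "D \<le> card (robust_nbhd V E m S) + g"
proof -
  let ?N = "robust_nbhd V E m S"
  have finX: "finite X" by (rule finite_subset[OF _ fin]) (use X in auto)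
  have finS: "finite S" by (rule finite_subset[OF X(2) fin])
  have NV: "?N \<subseteq> V" by (rule robust_nbhd_subset)
  have "card X * D \<le> (\<Sum>x\<in>X. card {u \<in> V. E x u})"
    using sum_mono[of X "\<lambda>_. D"] D by simp
  also have "\<dots> = (\<Sum>u\<in>V. card {x \<in> X. E x u})"
    by (rule sum_multicount_gen[OF finX fin]) simp
  also have "\<dots> = (\<Sum>u\<in>?N. card {x \<in> X. E x u}) + (\<Sum>u\<in>V - ?N. card {x \<in> X. E x u})"
    using sum.subset_diff[OF NV fin, of "\<lambda>u. card {x \<in> X. E x u}"] by simp
  also have "\<dots> \<le> (\<Sum>u\<in>?N. card X) + (\<Sum>u\<in>V - ?N. m)"
  proof (intro add_mono sum_mono)
    fix u assume "u \<in> ?N" then show "card {x \<in> X. E x u} \<le> card X" by (intro card_mono finX) auto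
  next
    fix u assume "u \<in> V - ?N"
    then have "card {x \<in> S. E x u} < m" by (auto simp: robust_nbhd_def)
    moreover have "card {x \<in> X. E x u} \<le> card {x \<in> S. E x u}" by (intro card_mono) (use X finS in auto)
    ultimately show "card {x \<in> X. E x u} \<le> m" by linarith
  qed
  also have "(\<Sum>u\<in>V - ?N. m) \<le> card V * m" using card_mono[OF fin, of "V - ?N"] by (simp add: Diff_subset)
  finally have "card X * D \<le> card ?N * card X + g * g" using m by simp
  also have "g * g \<le> g * card X" using X(3) by (rule mult_le_mono2)
  finally have "card X * D \<le> card X * (card ?N + g)" by (simp add: algebra_simps)
  then show ?thesis using X(3,4) by simp
qed

lemma robust_nbhd_of_large_indegree:
  assumes fin: "finite V" and Y: "Y \<subseteq> V" "S \<subseteq> V"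
    and D: "\<And>y. y \<in> Y \<Longrightarrow> card V + m \<le> card S + card {u \<in> V. E u y}"
  shows "card Y \<le> card (robust_nbhd V E m S)"
proof (rule card_mono)
  show "Y \<subseteq> robust_nbhd V E m S"
  proof
    fix y assume y: "y \<in> Y"
    have "{u \<in> V. E u y} \<inter> S = {u \<in> S. E u y}" using Y by auto
    then have "card V + m \<le> card V + card {u \<in> S. E u y}"
      using card_Int_ge[OF fin _ Y(2), of "{u \<in> V. E u y}"] D[OF y] by auto
    then show "y \<in> robust_nbhd V E m S" using y Y by (auto simp: robust_nbhd_def)
  qed
qed (simp add: fin)

text \<open>Here \<open>e\<close> plays the role of \<open>\<eta> n\<close>.\<close>

definition degree_condition :: "'a set \<Rightarrow> ('a \<Rightarrow> nat) \<Rightarrow> ('a \<Rightarrow> nat) \<Rightarrow> nat \<Rightarrow> bool" where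
  "degree_condition V d\<^sub>1 d\<^sub>2 e \<longleftrightarrow> (\<forall>i. 1 \<le> i \<longrightarrow> 2 * i < card V \<longrightarrow>
     card V + 1 \<le> i + card {v \<in> V. i + e \<le> d\<^sub>1 v} \<or> i + e \<le> card {v \<in> V. card V \<le> i + d\<^sub>2 v})"

lemma robust_expander_of_degree_condition:
  fixes E :: "'a \<Rightarrow> 'a \<Rightarrow> bool" and V :: "'a set"
  defines "dout \<equiv> \<lambda>v. card {u \<in> V. E v u}" and "din \<equiv> \<lambda>v. card {u \<in> V. E u v}"
  assumes fin: "finite V" and cond: "degree_condition V dout din e" "degree_condition V din dout e"
    and m: "1 \<le> m" "m \<le> g" "card V * m \<le> g * g" and e: "2 * g + m \<le> e" and n: "2 * g + 4 < card V"
  shows "robust_expander V E m (g + 1)"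
  unfolding robust_expander_def
proof (intro allI impI)
  fix S assume S: "S \<subseteq> V" "g + 1 \<le> card S"
  let ?n = "card V" and ?s = "card S" and ?N = "robust_nbhd V E m S"
  have s: "?s \<le> ?n" using S(1) fin by (rule card_mono[rotated])
  have out: "D \<le> card ?N + g" if "?n + g \<le> card {v \<in> V. D \<le> dout v} + ?s" for D
  proof (rule robust_nbhd_of_large_outdegree[OF fin _ S(1) _ _ _ m(3)])
    show "g \<le> card ({v \<in> V. D \<le> dout v} \<inter> S)"
      using card_Int_ge[OF fin _ S(1), of "{v \<in> V. D \<le> dout v}"] that by auto
  qed (use m in \<open>auto simp: dout_def\<close>)
  have inn: "card {v \<in> V. D \<le> din v} \<le> card ?N" if "?n + m \<le> ?s + D" for D
    by (rule robust_nbhd_of_large_indegree[OF fin _ S(1)]) (use that in \<open>auto simp: din_def\<close>)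
  have shift: "{v \<in> V. ?n \<le> i + f v} = {v \<in> V. ?n - i \<le> f v}" for i and f :: "'a \<Rightarrow> nat" by auto
  show "min (?s + m) (?n - (g + 1)) \<le> card ?N"
  proof (cases "2 * (?s - g) < ?n")
    case True
    define i where "i = ?s - g"
    have i: "1 \<le> i" "2 * i < ?n" "?s = i + g" using S(2) True by (auto simp: i_def)
    from cond(1) i(1,2) consider "?n + 1 \<le> i + card {v \<in> V. i + e \<le> dout v}"
      | "i + e \<le> card {v \<in> V. ?n - i \<le> din v}"
      unfolding degree_condition_def shift by blast
    then show ?thesis
    proof cases
      case 1
      then have "i + e \<le> card ?N + g" by (intro out) (use i in linarith)
      then show ?thesis using i e by linarith
    next
      case 2
      have "card {v \<in> V. ?n - i \<le> din v} \<le> card ?N" by (rule inn) (use i m(2) in linarith)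
      then show ?thesis using 2 i e m by linarith
    qed
  next
    case False
    define j where "j = max (?n + 1 - (?s + m)) (g + 2) - (g + 1)"
    have j: "1 \<le> j" "2 * j < ?n" using False n m(1) S(2) by (auto simp: j_def max_def)
    have j_ge: "?n \<le> ?s + j + m + g" by (auto simp: j_def)
    have j_min: "min (?s + m) (?n - (g + 1)) + j + g \<le> ?n"
      using n False by (auto simp: j_def max_def min_def)
    from cond(2) j(1,2) consider "?n + 1 \<le> j + card {v \<in> V. j + e \<le> din v}"
      | "j + e \<le> card {v \<in> V. ?n - j \<le> dout v}"
      unfolding degree_condition_def shift by blast
    then show ?thesis
    proof cases
      case 1
      have "card {v \<in> V. j + e \<le> din v} \<le> card ?N" by (rule inn) (use j_ge e m(2) in linarith)
      then show ?thesis using 1 j_min by linarith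
    next
      case 2
      then have "?n - j \<le> card ?N + g" by (intro out) (use j_ge e in linarith)
      then show ?thesis using j_min by linarith
    qed
  qed
qed

lemma min_degree_of_degree_condition:
  fixes E :: "'a \<Rightarrow> 'a \<Rightarrow> bool"
  assumes fin: "finite V" and irr: "\<And>v. \<not> E v v" and n: "2 < card V"
    and cond: "degree_condition V (\<lambda>v. card {u \<in> V. E v u}) (\<lambda>v. card {u \<in> V. E u v}) e" and v: "v \<in> V"
  shows "e \<le> card {u \<in> V. E v u}"
proof -
  let ?od = "\<lambda>v. card {u \<in> V. E v u}" and ?id = "\<lambda>v. card {u \<in> V. E u v}"
  from cond n consider "card V \<le> card {v \<in> V. 1 + e \<le> ?od v}" | "1 + e \<le> card {v \<in> V. card V \<le> 1 + ?id v}"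
    using cond[unfolded degree_condition_def, THEN spec, of 1] by auto
  then show ?thesis
  proof cases
    case 1
    then have "{v \<in> V. 1 + e \<le> ?od v} = V" using fin by (intro card_seteq) auto
    then have "1 + e \<le> ?od v" using v by blast
    then show ?thesis by simp
  next
    case 2
    have "{w \<in> V. card V \<le> 1 + ?id w} \<subseteq> insert v {u \<in> V. E v u}"
    proof
      fix w assume w: "w \<in> {w \<in> V. card V \<le> 1 + ?id w}"
      have "{u \<in> V. E u w} \<subseteq> V - {w}" using irr by auto
      moreover have "card (V - {w}) \<le> ?id w" using w fin by (simp add: le_diff_conv)
      ultimately have "{u \<in> V. E u w} = V - {w}" using fin by (intro card_seteq) auto
      then show "w \<in> insert v {u \<in> V. E v u}" using v w by auto
    qed
    then have "card {w \<in> V. card V \<le> 1 + ?id w} \<le> card (insert v {u \<in> V. E v u})"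
      by (intro card_mono) (use fin in auto)
    also have "\<dots> \<le> 1 + ?od v" using fin by (simp add: card_insert_if)
    finally show ?thesis using 2 by linarith
  qed
qed

lemma sorted_nth_count:
  fixes f :: "'a \<Rightarrow> nat"
  assumes fin: "finite V" and i: "1 \<le> i" "i \<le> card V"
    and x: "x \<le> sorted_list_of_multiset (image_mset f (mset_set V)) ! (i - 1)"
  shows "card V + 1 \<le> i + card {v \<in> V. x \<le> f v}"
proof -
  define xs where "xs = sorted_list_of_multiset (image_mset f (mset_set V))"
  have ms: "mset xs = image_mset f (mset_set V)" by (simp add: xs_def)
  have len: "length xs = card V" using arg_cong[OF ms, of size] by simp
  have "sorted xs" by (simp add: xs_def)
  have "x \<le> y" if "y \<in> set (drop (i - 1) xs)" for y
  proof -
    obtain l where l: "l < length xs - (i - 1)" "y = xs ! (i - 1 + l)"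
      using \<open>y \<in> _\<close> by (auto simp: in_set_conv_nth)
    have "xs ! (i - 1) \<le> xs ! (i - 1 + l)"
      by (rule sorted_nth_mono[OF \<open>sorted xs\<close>]) (use l(1) in auto)
    then show ?thesis using x l(2) unfolding xs_def[symmetric] by linarith
  qed
  then have "length (drop (i - 1) xs) = length (filter (\<lambda>y. x \<le> y) (drop (i - 1) xs))"
    by (metis filter_True)
  also have "\<dots> \<le> length (filter (\<lambda>y. x \<le> y) xs)"
    by (metis append_take_drop_id filter_append length_append le_add2)
  also have "\<dots> = size (filter_mset (\<lambda>y. x \<le> y) (mset xs))" by (metis mset_filter size_mset)
  also have "\<dots> = card {v \<in> V. x \<le> f v}"
    using fin by (simp add: ms filter_mset_image_mset)
  finally show ?thesis using len i by simp
qed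

section \<open>Hamilton cycles in robust expanders\<close>

definition hamilton_list :: "'a set \<Rightarrow> ('a \<Rightarrow> 'a \<Rightarrow> bool) \<Rightarrow> 'a list \<Rightarrow> bool" where
  "hamilton_list V E zs \<longleftrightarrow>
     zs \<noteq> [] \<and> distinct zs \<and> set zs = V \<and> successively E zs \<and> E (last zs) (hd zs)"

lemma matching_of_path_cover:
  assumes F: "path_cover E (mset_set V) F" and fin: "finite V"
  obtains \<rho> NS where "bij_betw \<rho> V V" "NS \<subseteq> V" "card (V - NS) \<le> size F"
    "\<And>b. b \<in> NS \<Longrightarrow> E (\<rho> b) b" "\<And>b. b \<in> NS \<Longrightarrow> \<rho> b \<noteq> b"
proof -
  obtain ps where ps: "F = mset ps" "distinct (concat ps)" "set (concat ps) = V"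
    "\<And>p. p \<in> set ps \<Longrightarrow> p \<noteq> [] \<and> successively E p"
    using path_cover_list[OF F fin] by blast
  obtain \<rho> where \<rho>: "bij_betw \<rho> V V"
    "\<And>p ys b zs. p \<in> set ps \<Longrightarrow> p = ys @ b # zs \<Longrightarrow> \<rho> b = (if ys = [] then last p else last ys)"
    using cyclic_pred_exists[OF ps(2)] ps(3,4) by metis
  define NS where "NS = V - hd ` set ps"
  have NS: "E (\<rho> b) b \<and> \<rho> b \<noteq> b" if "b \<in> NS" for b
  proof -
    obtain p where p: "p \<in> set ps" "b \<in> set p" using \<open>b \<in> NS\<close> ps(3) by (auto simp: NS_def)
    then obtain ys zs where split: "p = ys @ b # zs" by (meson split_list)
    have "b \<noteq> hd p" using \<open>b \<in> NS\<close> p(1) by (auto simp: NS_def)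
    then have "ys \<noteq> []" using split by auto
    then have "\<rho> b = last ys" using \<rho>(2)[OF p(1) split] by simp
    moreover have "distinct p" using ps(2) p(1) by (simp add: distinct_concat_iff)
    moreover have "successively E p" using ps(4) p(1) by blast
    ultimately show ?thesis using \<open>ys \<noteq> []\<close> split last_in_set[of ys]
      by (auto simp: successively_append_iff)
  qed
  have "V - NS \<subseteq> hd ` set ps" by (auto simp: NS_def)
  then have "card (V - NS) \<le> card (hd ` set ps)" by (intro card_mono) auto
  also have "\<dots> \<le> card (set ps)" by (rule card_image_le) simp
  also have "\<dots> \<le> size F" using card_length[of ps] ps(1) by simp
  finally show ?thesis using that[of \<rho> NS] \<rho>(1) NS by (auto simp: NS_def)
qed

lemma eventually_geometric_square:
  fixes a C :: nat
  shows "eventually (\<lambda>T. (a - 1) ^ T * (C * (T + 1))\<^sup>2 < a ^ T) sequentially \<or> a = 0"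
proof (cases "a = 0")
  case False
  define x where "x = sqrt (real (a - 1) / real a)"
  have x: "0 \<le> x" "x < 1" using False by (auto simp: x_def)
  have "(\<lambda>T. real T * x ^ T) \<longlonglongrightarrow> 0" by (rule powser_times_n_limit_0) (use x in auto)
  moreover have "(\<lambda>T. x ^ T) \<longlonglongrightarrow> 0" by (rule LIMSEQ_power_zero) (use x in auto)
  ultimately have "(\<lambda>T. real C * (real T * x ^ T + x ^ T)) \<longlonglongrightarrow> real C * (0 + 0)"
    by (intro tendsto_mult_left tendsto_add)
  then have "eventually (\<lambda>T. real C * (real T * x ^ T + x ^ T) < 1) sequentially"
    by (intro order_tendstoD(2)[where y = "real C * (0 + 0)"]) auto
  then have "eventually (\<lambda>T. (a - 1) ^ T * (C * (T + 1))\<^sup>2 < a ^ T) sequentially"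
  proof (rule eventually_mono)
    fix T assume *: "real C * (real T * x ^ T + x ^ T) < 1"
    have "(real C * (real T + 1) * x ^ T)\<^sup>2 < 1"
    proof -
      have "0 \<le> real C * (real T + 1) * x ^ T" using x by simp
      moreover have "real C * (real T + 1) * x ^ T < 1" using * by (simp add: algebra_simps)
      ultimately show ?thesis by (simp add: power_less_one_iff)
    qed
    also have "(real C * (real T + 1) * x ^ T)\<^sup>2 = (real C * (real T + 1))\<^sup>2 * (x\<^sup>2) ^ T"
      by (simp add: power_mult_distrib flip: power_mult) (simp add: mult.commute)
    also have "x\<^sup>2 = real (a - 1) / real a" unfolding x_def by simp
    finally have "(real C * (real T + 1))\<^sup>2 * real (a - 1) ^ T < real a ^ T"
      using False by (simp add: power_divide field_simps)
    then have "real ((a - 1) ^ T * (C * (T + 1))\<^sup>2) < real (a ^ T)"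
      by (simp add: algebra_simps)
    then show "(a - 1) ^ T * (C * (T + 1))\<^sup>2 < a ^ T" by (simp only: of_nat_less_iff)
  qed
  then show ?thesis ..
qed simp

lemma robust_expander_hamilton:
  fixes B :: nat
  assumes B: "32 \<le> B"
  obtains n\<^sub>0 where "\<forall>(V :: 'a set) E. finite V \<longrightarrow> n\<^sub>0 \<le> card V \<longrightarrow>
    robust_expander V E (card V div B div (2 * B)) (card V div B + 1) \<longrightarrow>
    (\<forall>v\<in>V. 16 * (card V div B) \<le> card {u \<in> V. E v u} \<and> 16 * (card V div B) \<le> card {u \<in> V. E u v}) \<longrightarrow>
    (\<exists>zs. hamilton_list V E zs)"
proof -
  define H where "H = 32 * B\<^sup>2"
  define C2 where "C2 = (H + 3) * (2 * H ^ (H + 2)) + 1"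
  define K where "K = 2 * C2"
  define bc where "bc = (H + 3) * (H + 3) + H + 2"
  define C4 where "C4 = 8 * K * bc"
  define A where "A = 2 * B"
  have pos: "C2 > 0" "K > 0" "C4 > 0" "A > 0" "H > 0"
    using B by (simp_all add: C2_def K_def bc_def C4_def A_def H_def)
  have "eventually (\<lambda>T. (A\<^sup>2 - 1) ^ T * (H * C4 * (T + 1))\<^sup>2 < (A\<^sup>2) ^ T) sequentially"
    using eventually_geometric_square[of "A\<^sup>2" "H * C4"] pos by simp
  then obtain T0 where T0: "\<And>T. T0 \<le> T \<Longrightarrow> (A\<^sup>2 - 1) ^ T * (H * C4 * (T + 1))\<^sup>2 < (A\<^sup>2) ^ T"
    by (auto simp: eventually_sequentially)
  define C where "C = C2 + K + 8 * (K * (H + 2) + H + 4) + 2 * ((H + 3) * (H + 3)) + 4 + C4 * T0"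
  show ?thesis
  proof (rule that[of "16 * B\<^sup>2 * C"], intro allI impI)
    fix V :: "'a set" and E
    assume fin: "finite V" and n0: "16 * B\<^sup>2 * C \<le> card V"
      and robust_expander: "robust_expander V E (card V div B div (2 * B)) (card V div B + 1)"
      and degs: "\<forall>v\<in>V. 16 * (card V div B) \<le> card {u \<in> V. E v u} \<and> 16 * (card V div B) \<le> card {u \<in> V. E u v}"
    define n where "n = card V"
    define g where "g = n div B"
    have out: "16 * g \<le> card {u \<in> V. E v u}" and inn: "16 * g \<le> card {u \<in> V. E u v}" if "v \<in> V" for v
      using degs that by (simp_all add: g_def n_def)
    define M0 where "M0 = g div (2 * B)"
    define m where "m = M0 div 8"
    define z where "z = m div 4"
    define L where "L = m div C2"
    define T where "T = m div C4"
    have m_eq: "m = n div (16 * B\<^sup>2)"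
      unfolding m_def M0_def g_def by (simp add: div_mult2_eq[symmetric] power2_eq_square ac_simps)
    have Cm: "C \<le> m" unfolding m_eq using n0 B by (simp add: less_eq_div_iff_mult_less_eq n_def ac_simps)
    have m_ge: "C2 \<le> m" "K \<le> m" "8 * (K * (H + 2) + H + 4) \<le> m" "2 * ((H + 3) * (H + 3)) + 4 \<le> m" "C4 * T0 \<le> m"
      using Cm unfolding C_def by linarith+
    have m4: "4 \<le> m" using m_ge(4) by linarith
    have nH: "n \<le> H * m"
    proof -
      have "n < 16 * B\<^sup>2 * (m + 1)"
        unfolding m_eq using B dividend_less_div_times[of "16 * B\<^sup>2" n] by (simp add: algebra_simps)
      also have "\<dots> \<le> 16 * B\<^sup>2 * (2 * m)" using m_ge(4) by (intro mult_le_mono2) linarith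
      finally show ?thesis by (simp add: H_def)
    qed
    have M0: "8 * m \<le> M0" unfolding m_def by simp
    have "64 * M0 \<le> 2 * B * M0" using B by (intro mult_le_mono1) simp
    also have "\<dots> \<le> g" unfolding M0_def by simp
    finally have gm: "512 * m \<le> g" using M0 by linarith
    have "32 * g \<le> B * g" using B by (intro mult_le_mono1)
    also have "\<dots> \<le> n" unfolding g_def by simp
    finally have gn: "32 * g \<le> n" .
    have zm: "4 * z \<le> m" unfolding z_def by simp
    have L: "L > 0" unfolding L_def using m_ge(1) pos by (simp add: div_greater_zero_iff)
    have LC: "C2 * L \<le> m" unfolding L_def by simp
    have mL: "m \<le> K * L"
    proof -
      have "m < C2 * (L + 1)" unfolding L_def using dividend_less_div_times[OF pos(1), of m] by (simp add: algebra_simps)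
      also have "\<dots> \<le> C2 * (2 * L)" using L by (intro mult_le_mono2) simp
      finally show ?thesis by (simp add: K_def)
    qed
    have TC: "C4 * T \<le> m" unfolding T_def by simp
    have TT: "T0 \<le> T" unfolding T_def using m_ge(5) pos by (simp add: less_eq_div_iff_mult_less_eq ac_simps)
    have T: "(A\<^sup>2 - 1) ^ T * n\<^sup>2 < (A\<^sup>2) ^ T"
    proof -
      have "m \<le> C4 * (T + 1)" unfolding T_def using dividend_less_div_times[OF pos(3), of m] by (simp add: algebra_simps)
      then have "H * m \<le> H * (C4 * (T + 1))" by (rule mult_le_mono2)
      then have "n \<le> H * C4 * (T + 1)" using nH by (metis mult.assoc order_trans)
      then have "n\<^sup>2 \<le> (H * C4 * (T + 1))\<^sup>2" by (rule power_mono) simp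
      then have "(A\<^sup>2 - 1) ^ T * n\<^sup>2 \<le> (A\<^sup>2 - 1) ^ T * (H * C4 * (T + 1))\<^sup>2" by (rule mult_le_mono2)
      then show ?thesis using T0[OF TT] by linarith
    qed
    have robust_expander': "robust_expander V E M0 (g + 1)" using robust_expander by (simp add: M0_def g_def n_def)
    have cover: "\<exists>F. path_cover E (mset_set (V - W)) F \<and> size F \<le> K" if W: "W \<subseteq> V" "card W \<le> z" for W
    proof -
      have cVW: "card (V - W) = n - card W" unfolding n_def by (intro card_Diff_subset) (use W fin finite_subset in auto)
      have finW: "finite W" using W(1) fin finite_subset by blast
      have deg: "16 * g - z \<le> card {u \<in> V - W. P u}" if "16 * g \<le> card {u \<in> V. P u}" for P
      proof -
        have "{u \<in> V - W. P u} = {u \<in> V. P u} - W" by auto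
        then show ?thesis using diff_card_le_card_Diff[OF finW, of "{u \<in> V. P u}"] that W(2) by simp
      qed
      have nW: "card W < n" using W(2) zm gm gn L LC m_ge by linarith
      have "robust_expander (V - W) E (M0 - z) (g + 1)" by (rule robust_expander_delete[OF robust_expander' fin W])
      then have r: "robust_expander (V - W) E (m + m) (g + 1)" by (rule robust_expander_mono) (use fin M0 zm in auto)
      have "(H + 3) * (2 * H ^ (H + 2) * L) < C2 * L" using L unfolding C2_def by (simp add: algebra_simps)
      then have c: "(H + 3) * (2 * H ^ (H + 2) * L) < m" using LC by linarith
      have "0 < card (V - W)" using nW cVW by linarith
      then have ne: "V - W \<noteq> {}" by (metis card.empty less_numeral_extra(3))
      obtain F where F: "path_cover E (mset_set (V - W)) F" "size F * (H * L) \<le> card (V - W) \<or> size F = 1"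
      proof (rule path_cover_exists[OF _ ne r _ _ _ _ _ _ L c])
        show "finite (V - W)" using fin by simp
        show "16 * g - z \<le> card {u \<in> V - W. E v u}" if "v \<in> V - W" for v
          by (rule deg) (use that out in simp)
        show "16 * g - z \<le> card {u \<in> V - W. E u v}" if "v \<in> V - W" for v
          by (rule deg) (use that inn in simp)
        show "g + 1 + 2 * m + m \<le> 16 * g - z" using gm zm m_ge(4) by linarith
        have "card W \<le> m" using W(2) zm by linarith
        moreover have "3 * m + 2 \<le> g" using gm m4 by linarith
        ultimately have "2 * (g + 1 + m) + card W \<le> n" using gn unfolding distrib_left by linarith
        then show "2 * (g + 1 + m) \<le> card (V - W)" unfolding cVW by linarith
        show "card (V - W) \<le> H * m" "card (V - W) \<le> H * m" unfolding cVW using nH by simp_all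
      qed
      have "size F \<le> K"
      proof (cases "size F = 1")
        case False
        then have "size F * (H * L) \<le> H * m" using F(2) cVW nH by linarith
        also have "\<dots> \<le> H * (K * L)" using mL by (rule mult_le_mono2)
        finally have "size F * (H * L) \<le> K * (H * L)" by (simp add: ac_simps)
        then show ?thesis using L pos(5) by simp
      qed (use pos(2) in simp)
      with F(1) show ?thesis by blast
    qed
    obtain F where F: "path_cover E (mset_set V) F" "size F \<le> K" using cover[of "{}"] by auto
    obtain \<rho> NS where \<rho>: "bij_betw \<rho> V V" "NS \<subseteq> V" "card (V - NS) \<le> size F"
      "\<And>b. b \<in> NS \<Longrightarrow> E (\<rho> b) b" "\<And>b. b \<in> NS \<Longrightarrow> \<rho> b \<noteq> b"
      using matching_of_path_cover[OF F(1) fin] by metis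
    interpret absorption V E m m "g + 1" "16 * g" H \<rho> NS z g A
    proof
      show "robust_expander V E (m + m) (g + 1)" by (rule robust_expander_mono[OF robust_expander' fin]) (use M0 in auto)
      show "even H" by (simp add: H_def)
      show "card (V - NS) \<le> m" using \<rho>(3) F(2) m_ge(2) by linarith
      show "card V \<le> A * g"
      proof -
        have "n < B * (g + 1)" unfolding g_def using B dividend_less_div_times[of B n] by (simp add: algebra_simps)
        also have "\<dots> \<le> B * (2 * g)" using gm m_ge(4) by (intro mult_le_mono2) linarith
        finally show ?thesis by (simp add: A_def n_def)
      qed
      show "2 * z + (H + 3) * (H + 3) + 1 < m" using zm m_ge(4) by linarith
      show "g + 1 + 2 * m + m \<le> 16 * g" using gm m_ge(4) by linarith
      show "2 * (g + 1 + m) \<le> card V" using gm gn m4 unfolding n_def distrib_left by linarith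
      show "g + 2 * z + m + 3 \<le> 16 * g" using gm zm m_ge(4) by linarith
    qed (use fin out inn nH \<rho> in \<open>auto simp: n_def\<close>)
    have cost: "K * (H + 2 + T * ((H + 3) * (H + 3) + H + 2)) + H + 2 \<le> z"
    proof -
      have "8 * (K * (T * bc)) \<le> m" using TC by (simp add: C4_def ac_simps)
      then have "8 * (K * (H + 2 + T * bc) + H + 4) \<le> 2 * m" using m_ge(3) by (simp add: algebra_simps)
      then have "(K * (H + 2 + T * bc) + H + 2) * 4 \<le> m" by simp
      then have "K * (H + 2 + T * bc) + H + 2 \<le> m div 4" by (simp only: less_eq_div_iff_mult_less_eq zero_less_numeral)
      then show ?thesis by (simp add: z_def bc_def)
    qed
    have zV: "z < card V" using zm gm gn m_ge(4) unfolding n_def by linarith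
    obtain zs where "zs \<noteq> []" "distinct zs" "set zs = V" "successively E zs" "E (last zs) (hd zs)"
      using hamilton_list_exists[OF T[unfolded n_def] cost zV cover] by blast
    then show "\<exists>zs. hamilton_list V E zs" by (auto simp: hamilton_list_def)
  qed
qed

lemma arc_list_exists:
  fixes G :: "('a, 'b) pre_digraph"
  assumes "zs \<noteq> []" "successively (dominates G) (zs @ [w])"
  shows "\<exists>p. pre_digraph.cas G (hd zs) p w \<and> set p \<subseteq> arcs G \<and> map (tail G) p = zs \<and>
    pre_digraph.awalk_verts G (hd zs) p = zs @ [w]"
  using assms
proof (induction zs)
  case (Cons z zs)
  let ?w = "hd (zs @ [w])"
  have "dominates G z ?w" using Cons.prems(2) by (cases zs) auto
  then obtain a where a: "a \<in> arcs G" "tail G a = z" "head G a = ?w" by auto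
  show ?case
  proof (cases "zs = []")
    case True
    then show ?thesis using a
      by (intro exI[of _ "[a]"]) (auto simp: pre_digraph.cas.simps pre_digraph.awalk_verts.simps)
  next
    case False
    then obtain p where "pre_digraph.cas G (hd zs) p w" "set p \<subseteq> arcs G" "map (tail G) p = zs"
      "pre_digraph.awalk_verts G (hd zs) p = zs @ [w]"
      using Cons by (auto simp: successively_Cons)
    then show ?thesis using a False
      by (intro exI[of _ "a # p"]) (auto simp: pre_digraph.cas.simps pre_digraph.awalk_verts.simps)
  qed
qed simp

lemma hamilton_cycle_of_list:
  assumes "hamilton_list (verts G) (dominates G) zs"
  shows "\<exists>p. hamilton_cycle G p"
proof -
  have zs: "zs \<noteq> []" "distinct zs" "set zs = verts G" "successively (dominates G) (zs @ [hd zs])"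
    using assms by (auto simp: hamilton_list_def successively_append_iff)
  then obtain p where p: "pre_digraph.cas G (hd zs) p (hd zs)" "set p \<subseteq> arcs G" "map (tail G) p = zs"
    "pre_digraph.awalk_verts G (hd zs) p = zs @ [hd zs]"
    using arc_list_exists[OF zs(1,4)] by blast
  have "hd zs \<in> verts G" using zs(1,3) by (metis hd_in_set)
  moreover have "distinct (tl (zs @ [hd zs]))" using zs(1,2) by (cases zs) auto
  moreover have "p \<noteq> []" using p(3) zs(1) by auto
  ultimately have "pre_digraph.cycle G p"
    unfolding pre_digraph.cycle_def pre_digraph.awalk_def using p by (intro exI[of _ "hd zs"]) simp
  moreover have "tail G ` set p = verts G" using p(3) zs(3) by (metis set_map)
  ultimately show ?thesis unfolding hamilton_cycle_def by blast
qed

lemma (in digraph) degrees_card: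
  "out_degree G v = card {u \<in> verts G. dominates G v u}" "in_degree G v = card {u \<in> verts G. dominates G u v}"
proof -
  have "inj_on (head G) (out_arcs G v)" "inj_on (tail G) (in_arcs G v)"
    by (auto intro!: inj_onI no_multi_arcs simp: arc_to_ends_def)
  moreover have "{u \<in> verts G. dominates G v u} = head G ` out_arcs G v"
    "{u \<in> verts G. dominates G u v} = tail G ` in_arcs G v"
    by (auto simp: arcs_ends_conv)
  ultimately show "out_degree G v = card {u \<in> verts G. dominates G v u}"
    "in_degree G v = card {u \<in> verts G. dominates G u v}"
    by (simp_all add: out_degree_def in_degree_def card_image)
qed

lemma degree_condition_of_sequences:
  fixes V :: "'a set" and f\<^sub>1 f\<^sub>2 :: "'a \<Rightarrow> nat" and \<eta> :: real
  defines "s\<^sub>1 \<equiv> \<lambda>i. sorted_list_of_multiset (image_mset f\<^sub>1 (mset_set V)) ! (i - 1)"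
    and "s\<^sub>2 \<equiv> \<lambda>i. sorted_list_of_multiset (image_mset f\<^sub>2 (mset_set V)) ! (i - 1)"
  assumes fin: "finite V" and n: "card V = n" and \<eta>: "\<eta> > 0" and e: "real e \<le> \<eta> * real n"
    and cond: "\<And>i. 1 \<le> i \<Longrightarrow> real i < real n / 2 \<Longrightarrow> real i + \<eta> * real n \<le> real (s\<^sub>1 i) \<or>
      seq_ge_at s\<^sub>2 (real n - real i - \<eta> * real n) (n - i)"
  shows "degree_condition V f\<^sub>1 f\<^sub>2 e"
  unfolding degree_condition_def n
proof (intro allI impI)
  fix i :: nat assume i: "1 \<le> i" "2 * i < n"
  then have "real i < real n / 2" by linarith
  from cond[OF i(1) this]
  show "n + 1 \<le> i + card {v \<in> V. i + e \<le> f\<^sub>1 v} \<or> i + e \<le> card {v \<in> V. n \<le> i + f\<^sub>2 v}"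
  proof
    assume "real i + \<eta> * real n \<le> real (s\<^sub>1 i)"
    then have "i + e \<le> s\<^sub>1 i" using e by linarith
    then show ?thesis
      using sorted_nth_count[OF fin i(1), of "i + e" f\<^sub>1] i n unfolding s\<^sub>1_def by auto
  next
    let ?x = "real n - real i - \<eta> * real n"
    define j where "j = nat \<lceil>?x\<rceil>"
    assume "seq_ge_at s\<^sub>2 ?x (n - i)"
    then have j: "1 \<le> j" "n - i \<le> s\<^sub>2 j" "real j < ?x + 1"
      unfolding seq_ge_at_def j_def by (auto, linarith+)
    have "0 \<le> \<eta> * real n" using \<eta> by simp
    then have "j \<le> n" using j(3) i by linarith
    then have "n + 1 \<le> j + card {v \<in> V. n - i \<le> f\<^sub>2 v}"
      using sorted_nth_count[OF fin j(1), of "n - i" f\<^sub>2] j(2) n unfolding s\<^sub>2_def by auto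
    moreover have "{v \<in> V. n - i \<le> f\<^sub>2 v} = {v \<in> V. n \<le> i + f\<^sub>2 v}" by auto
    ultimately have "n + 1 \<le> j + card {v \<in> V. n \<le> i + f\<^sub>2 v}" by simp
    then have "i + e \<le> card {v \<in> V. n \<le> i + f\<^sub>2 v}" using j(3) e by linarith
    then show ?thesis ..
  qed
qed

theorem theorem2:
  shows "\<forall>\<eta>::real. \<eta> > 0 \<longrightarrow> (\<exists>n\<^sub>0::nat. \<forall>(G :: ('a, 'b) pre_digraph) n.
    digraph G \<longrightarrow> card (verts G) = n \<longrightarrow> n \<ge> n\<^sub>0 \<longrightarrow>
    (\<forall>i::nat. 1 \<le> i \<longrightarrow> real i < real n / 2 \<longrightarrow>
       (real (outdeg_seq G i) \<ge> real i + \<eta> * real n \<or>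
        seq_ge_at (indeg_seq G) (real n - real i - \<eta> * real n) (n - i)) \<and>
       (real (indeg_seq G i) \<ge> real i + \<eta> * real n \<or>
        seq_ge_at (outdeg_seq G) (real n - real i - \<eta> * real n) (n - i))) \<longrightarrow>
    (\<exists>p. hamilton_cycle G p))"
proof (intro allI impI)
  fix \<eta> :: real assume \<eta>: "\<eta> > 0"
  obtain B0 :: nat where B0: "16 / \<eta> \<le> real B0" using real_arch_simple by blast
  define B where "B = max 32 B0"
  have "16 \<le> \<eta> * real B0" using B0 \<eta> by (simp add: field_simps)
  also have "\<dots> \<le> \<eta> * real B" using \<eta> by (intro mult_left_mono) (simp_all add: B_def)
  finally have B: "32 \<le> B" "16 \<le> \<eta> * real B" by (simp_all add: B_def)
  obtain n1 where n1: "\<forall>(V :: 'a set) E. finite V \<longrightarrow> n1 \<le> card V \<longrightarrow>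
    robust_expander V E (card V div B div (2 * B)) (card V div B + 1) \<longrightarrow>
    (\<forall>v\<in>V. 16 * (card V div B) \<le> card {u \<in> V. E v u} \<and> 16 * (card V div B) \<le> card {u \<in> V. E u v}) \<longrightarrow>
    (\<exists>zs. hamilton_list V E zs)"
    using robust_expander_hamilton[OF B(1)] by blast
  show "\<exists>n\<^sub>0::nat. \<forall>(G :: ('a, 'b) pre_digraph) n.
    digraph G \<longrightarrow> card (verts G) = n \<longrightarrow> n \<ge> n\<^sub>0 \<longrightarrow>
    (\<forall>i::nat. 1 \<le> i \<longrightarrow> real i < real n / 2 \<longrightarrow>
       (real (outdeg_seq G i) \<ge> real i + \<eta> * real n \<or>
        seq_ge_at (indeg_seq G) (real n - real i - \<eta> * real n) (n - i)) \<and>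
       (real (indeg_seq G i) \<ge> real i + \<eta> * real n \<or>
        seq_ge_at (outdeg_seq G) (real n - real i - \<eta> * real n) (n - i))) \<longrightarrow>
    (\<exists>p. hamilton_cycle G p)"
  proof (intro exI[of _ "max n1 (2 * B * B)"] allI impI)
    fix G :: "('a, 'b) pre_digraph" and n
    assume G: "digraph G" "card (verts G) = n" "max n1 (2 * B * B) \<le> n"
      and cond: "\<forall>i::nat. 1 \<le> i \<longrightarrow> real i < real n / 2 \<longrightarrow>
       (real (outdeg_seq G i) \<ge> real i + \<eta> * real n \<or>
        seq_ge_at (indeg_seq G) (real n - real i - \<eta> * real n) (n - i)) \<and>
       (real (indeg_seq G i) \<ge> real i + \<eta> * real n \<or>
        seq_ge_at (outdeg_seq G) (real n - real i - \<eta> * real n) (n - i))"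
    interpret digraph G by (rule G(1))
    let ?V = "verts G" and ?E = "dominates G"
    define g where "g = n div B"
    have "2 * B \<le> g" unfolding g_def using G(3) B(1) by (simp add: less_eq_div_iff_mult_less_eq)
    then have g: "1 \<le> g div (2 * B)" "1 \<le> g" using B(1) by (simp_all add: less_eq_div_iff_mult_less_eq)
    have "32 * g \<le> B * g" using B(1) by (rule mult_le_mono1)
    also have Bg: "B * g \<le> n" unfolding g_def by simp
    finally have gn: "32 * g \<le> n" .
    have "16 * real g \<le> \<eta> * real B * real g" using B(2) by (rule mult_right_mono) simp
    also have "\<dots> \<le> \<eta> * real n" using Bg \<eta> by (simp add: mult.assoc flip: of_nat_mult)
    finally have e: "real (16 * g) \<le> \<eta> * real n" by simp
    have nm: "n * (g div (2 * B)) \<le> g * g"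
    proof -
      have "n < B * (g + 1)" unfolding g_def using B(1) dividend_less_div_times[of B n] by (simp add: algebra_simps)
      also have "\<dots> \<le> B * (2 * g)" using g(2) by (intro mult_le_mono2) linarith
      finally have "n \<le> g * (2 * B)" by (simp add: ac_simps)
      then have "n * (g div (2 * B)) \<le> g * (2 * B) * (g div (2 * B))" by (rule mult_le_mono1)
      also have "\<dots> = g * (2 * B * (g div (2 * B)))" by (simp only: mult.assoc)
      also have "\<dots> \<le> g * g" by (intro mult_le_mono2) simp
      finally show ?thesis .
    qed
    have c1: "degree_condition ?V (out_degree G) (in_degree G) (16 * g)"
      by (rule degree_condition_of_sequences[OF _ G(2) \<eta> e])
        (use cond in \<open>auto simp: outdeg_seq_def[abs_def] indeg_seq_def[abs_def]\<close>)
    have c2: "degree_condition ?V (in_degree G) (out_degree G) (16 * g)"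
      by (rule degree_condition_of_sequences[OF _ G(2) \<eta> e])
        (use cond in \<open>auto simp: outdeg_seq_def[abs_def] indeg_seq_def[abs_def]\<close>)
    note cs = c1[unfolded degrees_card[abs_def]] c2[unfolded degrees_card[abs_def]]
    have gB: "g div (2 * B) \<le> g" by simp
    have "2 * g + g div (2 * B) \<le> 16 * g" "2 * g + 4 < card ?V" using gB gn g(2) G(2) by linarith+
    from robust_expander_of_degree_condition[OF finite_verts cs g(1) gB nm[folded G(2)] this]
    have "robust_expander ?V ?E (g div (2 * B)) (g + 1)" .
    moreover have "16 * g \<le> card {u \<in> ?V. ?E v u}" if "v \<in> ?V" for v
      by (rule min_degree_of_degree_condition[OF _ _ _ cs(1) that]) (use adj_not_same gn g G(2) in auto)
    moreover have "16 * g \<le> card {u \<in> ?V. ?E u v}" if "v \<in> ?V" for v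
      by (rule min_degree_of_degree_condition[where E = "\<lambda>u v. ?E v u", OF _ _ _ cs(2) that])
        (use adj_not_same gn g G(2) in auto)
    ultimately have "\<exists>zs. hamilton_list ?V ?E zs"
      using n1[rule_format, of ?V ?E] G(3) unfolding g_def G(2) by simp
    then show "\<exists>p. hamilton_cycle G p" using hamilton_cycle_of_list by blast
  qed
qed

end
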